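(* Let $H$ be a complex Hilbert space, let $T\in B(H)$, and suppose that the polynomial hull $\widehat{\sigma}(T)$ of $\sigma(T)$ contains the unit disc $\mathbb D$. Let $n\in\mathbb N$ and let $\tilde C$ be a strict contraction on a separable Hilbert space, i.e. a bounded linear operator with $\|\tilde C\|<1$. Then there exist a (closed) subspace $L\subset H$ and an operator $C\in B(L)$ unitarily equivalent to $\tilde C$ such that $$(T^k)_L=C^k\qquad\text{for } k=1,\dots,n.$$
   Context: $B(H)$ is the algebra of bounded linear operators on $H$, $\sigma(T)$ is the spectrum of $T$, and $\mathbb D=\{\lambda\in\mathbb C:|\lambda|<1\}$. For a compact set $K\subset\mathbb C$, its polynomial hull $\widehat K$ is the union of $K$ with all bounded components of $\mathbb C\setminus K$; $\widehat\sigma(T)$ is the polynomial hull of $\sigma(T)$. For a closed subspace $L\subset H$ and $S\in B(H)$, the compression $S_L\in B(L)$ is $S_L=J_L^*SJ_L$, where $J_L:L\to H$ is the inclusion (equivalently $S_Lx=P_LSx$ for $x\in L$, with $P_L$ the orthogonal projection onto $L$). *)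

theory Defs
  imports "HOL-Analysis.Analysis"
begin

(* The distribution has real inner product spaces only.  The class below adds complex scalars and a
   complex inner product (linear in the first argument) to a complete real_inner space.  The last
   axiom makes the norm and the topology inherited from real_inner the ones given by cinner:
   norm x = sqrt (Re (cinner x x)). *)

class complex_hilbert_space = real_inner + complete_space +
  fixes scaleC :: "complex \<Rightarrow> 'a \<Rightarrow> 'a" (infixr "*\<^sub>C" 75)
    and cinner :: "'a \<Rightarrow> 'a \<Rightarrow> complex"
  assumes scaleC_add_right: "a *\<^sub>C (x + y) = a *\<^sub>C x + a *\<^sub>C y"
    and scaleC_add_left: "(a + b) *\<^sub>C x = a *\<^sub>C x + b *\<^sub>C x"
    and scaleC_scaleC: "a *\<^sub>C (b *\<^sub>C x) = (a * b) *\<^sub>C x"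
    and scaleC_one: "1 *\<^sub>C x = x"
    and scaleR_eq_scaleC: "scaleR r x = complex_of_real r *\<^sub>C x"
    and cinner_commute: "cinner x y = cnj (cinner y x)"
    and cinner_add_left: "cinner (x + y) z = cinner x z + cinner y z"
    and cinner_scaleC_left: "cinner (a *\<^sub>C x) y = a * cinner x y"
    and inner_eq_Re_cinner: "inner x y = Re (cinner x y)"

definition csubspace :: "'a::complex_hilbert_space set \<Rightarrow> bool" where
  "csubspace L \<longleftrightarrow> 0 \<in> L \<and> (\<forall>x\<in>L. \<forall>y\<in>L. x + y \<in> L) \<and> (\<forall>a. \<forall>x\<in>L. a *\<^sub>C x \<in> L)"

definition clinear_on ::
  "'a::complex_hilbert_space set \<Rightarrow> ('a \<Rightarrow> 'b::complex_hilbert_space) \<Rightarrow> bool" where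
  "clinear_on L f \<longleftrightarrow>
     (\<forall>x\<in>L. \<forall>y\<in>L. f (x + y) = f x + f y) \<and> (\<forall>a. \<forall>x\<in>L. f (a *\<^sub>C x) = a *\<^sub>C f x)"

(* B(L) for a closed subspace L, with B(H) the case L = UNIV.  The elements are total functions;
   their values outside L are irrelevant. *)

definition bounded_operators :: "'a::complex_hilbert_space set \<Rightarrow> ('a \<Rightarrow> 'a) set" where
  "bounded_operators L =
     {f. (\<forall>x\<in>L. f x \<in> L) \<and> clinear_on L f \<and> (\<exists>M. \<forall>x\<in>L. norm (f x) \<le> M * norm x)}"

lemma bounded_operators_UNIV:
  "f \<in> bounded_operators UNIV \<longleftrightarrow> bounded_linear f \<and> (\<forall>a x. f (a *\<^sub>C x) = a *\<^sub>C f x)"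
proof
  assume f: "f \<in> bounded_operators UNIV"
  then have lin: "f (x + y) = f x + f y" "f (a *\<^sub>C x) = a *\<^sub>C f x" for x y a
    by (auto simp: bounded_operators_def clinear_on_def)
  obtain M where "norm (f x) \<le> M * norm x" for x
    using f by (auto simp: bounded_operators_def)
  then have "bounded_linear f"
    by (intro bounded_linear_intro[of f M])
      (auto simp: lin scaleR_eq_scaleC mult.commute)
  then show "bounded_linear f \<and> (\<forall>a x. f (a *\<^sub>C x) = a *\<^sub>C f x)"
    using lin by blast
next
  assume f: "bounded_linear f \<and> (\<forall>a x. f (a *\<^sub>C x) = a *\<^sub>C f x)"
  then obtain M where "\<forall>x. norm (f x) \<le> norm x * M"
    using bounded_linear.bounded by blast
  then have "\<forall>x. norm (f x) \<le> M * norm x"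
    by (simp add: mult.commute)
  with f show "f \<in> bounded_operators UNIV"
    by (auto simp: bounded_operators_def clinear_on_def linear_add bounded_linear.linear)
qed

definition op_spectrum :: "('a::complex_hilbert_space \<Rightarrow> 'a) \<Rightarrow> complex set" where
  "op_spectrum T =
     {\<mu>. \<not> (\<exists>S\<in>bounded_operators UNIV.
              \<forall>x. S (T x - \<mu> *\<^sub>C x) = x \<and> T (S x) - \<mu> *\<^sub>C S x = x)}"

definition polynomial_hull :: "complex set \<Rightarrow> complex set" where
  "polynomial_hull K = K \<union> \<Union>{U \<in> components (- K). bounded U}"

definition orth_proj :: "'a::complex_hilbert_space set \<Rightarrow> 'a \<Rightarrow> 'a" where
  "orth_proj L x = (THE y. y \<in> L \<and> (\<forall>z\<in>L. cinner (x - y) z = 0))"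

definition compression ::
  "'a::complex_hilbert_space set \<Rightarrow> ('a \<Rightarrow> 'a) \<Rightarrow> 'a \<Rightarrow> 'a" where
  "compression L S x = orth_proj L (S x)"

definition unitary_between ::
  "'a::complex_hilbert_space set \<Rightarrow> 'b::complex_hilbert_space set \<Rightarrow> ('a \<Rightarrow> 'b) \<Rightarrow> bool" where
  "unitary_between L M U \<longleftrightarrow>
     bij_betw U L M \<and> clinear_on L U \<and> (\<forall>x\<in>L. \<forall>y\<in>L. cinner (U x) (U y) = cinner x y)"

definition unitarily_equivalent ::
  "'a::complex_hilbert_space set \<Rightarrow> ('a \<Rightarrow> 'a) \<Rightarrow>
   'b::complex_hilbert_space set \<Rightarrow> ('b \<Rightarrow> 'b) \<Rightarrow> bool" where
  "unitarily_equivalent L A M B \<longleftrightarrow>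
     (\<exists>U. unitary_between L M U \<and> (\<forall>x\<in>L. U (A x) = B (U x)))"

(* The description in orth_proj is proper for closed subspaces. *)

lemma orth_proj_exists_unique:
  fixes L :: "'a::complex_hilbert_space set"
  assumes sub: "csubspace L" and cl: "closed L"
  shows "\<exists>!y. y \<in> L \<and> (\<forall>z\<in>L. cinner (x - y) z = 0)"
proof -
  have L0: "0 \<in> L" and Ladd: "a \<in> L \<Longrightarrow> b \<in> L \<Longrightarrow> a + b \<in> L"
    and LC: "a \<in> L \<Longrightarrow> c *\<^sub>C a \<in> L" for a b c
    using sub by (auto simp: csubspace_def)
  have LR: "r *\<^sub>R a \<in> L" if "a \<in> L" for r a
    using LC[OF that] by (simp add: scaleR_eq_scaleC)
  have Ldiff: "a - b \<in> L" if "a \<in> L" "b \<in> L" for a b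
    using Ladd[OF that(1) LR[OF that(2), of "-1"]] by simp
  define d where "d = infdist x L"
  have d0: "0 \<le> d" by (simp add: d_def infdist_nonneg)
  have dle: "d \<le> norm (x - a)" if "a \<in> L" for a
    using infdist_le[OF that, of x] by (simp add: d_def dist_norm)
  have "\<exists>a\<in>L. norm (x - a) < d + e" if "e > 0" for e
  proof -
    have "(INF a\<in>L. dist x a) < d + e"
      using that L0 by (auto simp: d_def infdist_def)
    moreover have "bdd_below (dist x ` L)" by (rule bdd_belowI[of _ 0]) auto
    ultimately show ?thesis
      using L0 by (subst (asm) cINF_less_iff) (auto simp: dist_norm)
  qed
  then have "\<exists>a\<in>L. norm (x - a) < d + 1 / Suc n" for n by simp
  then obtain Y where Y: "Y n \<in> L" "norm (x - Y n) < d + 1 / Suc n" for n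
    by metis
  have par: "(norm (a - b))\<^sup>2 \<le> 2 * (norm (x - a))\<^sup>2 + 2 * (norm (x - b))\<^sup>2 - 4 * d\<^sup>2"
    if "a \<in> L" "b \<in> L" for a b
  proof -
    have "d \<le> norm (x - (1/2) *\<^sub>R (a + b))"
      using that by (intro dle LR Ladd)
    then have "d\<^sup>2 \<le> (norm (x - (1/2) *\<^sub>R (a + b)))\<^sup>2"
      using d0 by (rule power_mono)
    then show ?thesis
      by (simp add: power2_norm_eq_inner inner_add inner_diff inner_commute algebra_simps)
  qed
  have bnd: "(norm (Y m - Y n))\<^sup>2 \<le> (8 * d + 4) / Suc N" if "m \<ge> N" "n \<ge> N" for m n N
  proof -
    let ?e = "1 / real (Suc N)"
    have e: "0 < ?e" "?e \<le> 1" by auto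
    have *: "(norm (x - Y k))\<^sup>2 \<le> d\<^sup>2 + (2 * d + 1) * ?e" if "k \<ge> N" for k
    proof -
      have "1 / real (Suc k) \<le> ?e" using that by (simp add: frac_le)
      then have "norm (x - Y k) \<le> d + ?e" using Y(2)[of k] by linarith
      then have "(norm (x - Y k))\<^sup>2 \<le> (d + ?e)\<^sup>2" by (rule power_mono) simp
      also have "\<dots> = d\<^sup>2 + 2 * d * ?e + ?e * ?e" by (simp add: power2_eq_square algebra_simps)
      also have "\<dots> \<le> d\<^sup>2 + 2 * d * ?e + 1 * ?e"
        by (intro add_left_mono mult_right_mono) (use e in auto)
      finally show ?thesis by (simp add: algebra_simps)
    qed
    have "(norm (Y m - Y n))\<^sup>2 \<le> 4 * ((2 * d + 1) * ?e)"
      using par[OF Y(1) Y(1), of m n] *[OF that(1)] *[OF that(2)] by linarith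
    then show ?thesis by (simp add: algebra_simps add_divide_distrib)
  qed
  have "Cauchy Y"
  proof (rule metric_CauchyI)
    fix e :: real assume e: "e > 0"
    obtain N where N: "(8 * d + 4) / e\<^sup>2 < real N" using reals_Archimedean2 by blast
    have "(8 * d + 4) / Suc N < e\<^sup>2"
    proof -
      have "(8 * d + 4) < real N * e\<^sup>2" using N e by (simp add: pos_divide_less_eq)
      also have "\<dots> \<le> real (Suc N) * e\<^sup>2" by (intro mult_right_mono) auto
      finally show ?thesis by (simp add: pos_divide_less_eq mult.commute)
    qed
    then have "norm (Y m - Y n) < e" if "m \<ge> N" "n \<ge> N" for m n
      using bnd[OF that] e by (intro power_less_imp_less_base[of _ 2 e]) auto
    then show "\<exists>M. \<forall>m\<ge>M. \<forall>n\<ge>M. dist (Y m) (Y n) < e"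
      by (auto simp: dist_norm)
  qed
  then obtain y where lim: "Y \<longlonglongrightarrow> y"
    using Cauchy_convergent convergent_def by blast
  have yL: "y \<in> L" using closed_sequentially[OF cl _ lim] Y(1) by blast
  have "norm (x - y) \<le> d"
  proof (rule LIMSEQ_le)
    show "(\<lambda>n. norm (x - Y n)) \<longlonglongrightarrow> norm (x - y)" by (intro tendsto_intros lim)
    show "(\<lambda>n. d + 1 / Suc n) \<longlonglongrightarrow> d"
      using tendsto_add[OF tendsto_const[of d] LIMSEQ_inverse_real_of_nat]
      by (simp add: inverse_eq_divide)
    show "\<exists>N. \<forall>n\<ge>N. norm (x - Y n) \<le> d + 1 / Suc n" using Y(2) less_imp_le by blast
  qed
  have R: "inner (x - y) z = 0" if z: "z \<in> L" for z
  proof (cases "z = 0")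
    case False
    let ?t = "inner (x - y) z / inner z z"
    have zz: "inner z z > 0" using False by simp
    have expand: "(norm (u - t *\<^sub>R z))\<^sup>2 =
        (norm u)\<^sup>2 - 2 * t * inner u z + t * (t * inner z z)" for u t
      by (simp add: power2_norm_eq_inner inner_diff_left inner_diff_right
          inner_commute[of z u] algebra_simps)
    have "norm (x - y) \<le> norm (x - (y + ?t *\<^sub>R z))"
      using \<open>norm (x - y) \<le> d\<close> dle[OF Ladd[OF yL LR[OF z]]] by (rule order_trans)
    then have "(norm (x - y))\<^sup>2 \<le> (norm ((x - y) - ?t *\<^sub>R z))\<^sup>2"
      by (intro power_mono) (auto simp: algebra_simps)
    also have "\<dots> = (norm (x - y))\<^sup>2 - 2 * ?t * inner (x - y) z + ?t * (?t * inner z z)"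
      by (rule expand)
    also have "?t * inner z z = inner (x - y) z" using zz by simp
    finally have "?t * inner (x - y) z \<le> 0" by linarith
    then have "(inner (x - y) z)\<^sup>2 \<le> 0" using zz
      by (simp add: power2_eq_square divide_le_0_iff)
    then show ?thesis by simp
  qed simp
  have C: "cinner (x - y) z = 0" if z: "z \<in> L" for z
  proof -
    have "cinner (x - y) (\<i> *\<^sub>C z) = - \<i> * cinner (x - y) z"
      using cinner_commute[of "x - y" "\<i> *\<^sub>C z"] cinner_commute[of "x - y" z]
      by (simp add: cinner_scaleC_left)
    then have "Im (cinner (x - y) z) = 0"
      using R[OF LC[OF z, of \<i>]] by (simp add: inner_eq_Re_cinner)
    then show ?thesis using R[OF z] by (simp add: inner_eq_Re_cinner complex_eq_iff)
  qed
  show ?thesis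
  proof (rule ex1I[of _ y])
    show "y \<in> L \<and> (\<forall>z\<in>L. cinner (x - y) z = 0)" using yL C by blast
    fix w assume w: "w \<in> L \<and> (\<forall>z\<in>L. cinner (x - w) z = 0)"
    then have "w - y \<in> L" using Ldiff yL by blast
    then have "inner (x - y) (w - y) = 0" "inner (x - w) (w - y) = 0"
      using R w by (auto simp: inner_eq_Re_cinner)
    then have "inner (w - y) (w - y) = 0"
      by (simp add: inner_diff_left)
    then show "w = y" by simp
  qed
qed

end

theory Submission
  imports Defs "HOL-Complex_Analysis.Conformal_Mappings"
begin

text \<open>
  It is enough to find a linear map \<open>V\<close> from the space of the contraction \<open>C'\<close> to \<open>H\<close> with
  \<open>\<langle>T ^^ k (V x), V y\<rangle> = \<langle>C' ^^ k x, y\<rangle>\<close> for \<open>k \<le> n\<close>: for \<open>k = 0\<close> it is isometric, its range is the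
  subspace \<open>L\<close>, and for \<open>k \<ge> 1\<close> the equations say that \<open>T ^^ k\<close> compresses to the transported power of \<open>C'\<close>.

  On the side of the contraction, a truncated Poisson kernel evaluated at roots of unity writes all
  powers \<open>C' ^^ k\<close>, \<open>k \<le> n\<close>, as \<open>\<Sum>j. lam j ^ k A j\<close> with the same finitely many points \<open>lam j\<close> of the
  open disc and the same positive operators \<open>A j\<close> (\<open>strict_contraction_quadrature\<close>). Each
  \<open>\<langle>A j x, y\<rangle>\<close> is a series of products of functionals, by symmetric Gaussian elimination
  along a dense sequence (\<open>positive_form_decomposition\<close>). So it remains to find in \<open>H\<close>, for each \<open>j\<close>,
  infinitely many unit vectors \<open>e\<close> with \<open>\<langle>T ^^ k e, e\<rangle> = lam j ^ k\<close> whose images under these powers are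
  orthogonal to the other vectors; they can be chosen one after the other if, for \<open>\<zeta>\<close> in the disc, such
  a vector exists in the orthogonal complement of every finite set (\<open>vector_with_prescribed_moments\<close>).

  This is where the spectrum enters. Let \<open>\<mu>\<close> range over the points that admit approximate eigenvectors
  of \<open>T\<close> orthogonal to any given finite set. If for some nonconstant polynomial \<open>p\<close> no such \<open>\<mu>\<close> satisfied
  \<open>Re (p \<mu>) > Re (p \<zeta>)\<close>, the maximum principle would produce a path to infinity from a point of the
  disc along which \<open>T - z\<close> is bounded below on a subspace of finite codimension. Along such a path the
  spectrum cannot begin to fill an open set, by a form of the analytic Fredholm theorem
  (\<open>countable_noninvertible\<close>), and points of the disc would fall outside the polynomial hull of the
  spectrum; this is \<open>approx_ess_spectrum_exceeds\<close>. Hence \<open>(\<zeta>, \<dots>, \<zeta> ^ n)\<close> is an interior point of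
  the convex hull of the points \<open>(\<mu>, \<dots>, \<mu> ^ n)\<close>. Being interior it remains in the convex hull when
  these are replaced by the moments of approximate eigenvectors, and a suitable combination of
  approximate eigenvectors with mutually orthogonal orbits has exactly the moments \<open>\<zeta> ^ k\<close>.
\<close>

section \<open>Complex Hilbert space\<close>

interpretation scaleC: module "scaleC :: complex \<Rightarrow> 'a::complex_hilbert_space \<Rightarrow> 'a"
  by unfold_locales (simp_all add: scaleC_add_right scaleC_add_left scaleC_scaleC scaleC_one)

lemma cinner_add_right: "cinner x (y + z) = cinner x y + cinner x z"
  by (metis cinner_add_left cinner_commute complex_cnj_add)

lemma cinner_scaleC_right: "cinner x (a *\<^sub>C y) = cnj a * cinner x y"
  by (metis cinner_commute cinner_scaleC_left complex_cnj_mult)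

lemma cinner_self: "cinner x x = complex_of_real ((norm x)\<^sup>2)"
proof -
  have "Im (cinner x x) = 0"
    using cinner_commute[of x x] by (metis cnj.simps(2) equal_neg_zero)
  then show ?thesis
    by (simp add: complex_eq_iff flip: inner_eq_Re_cinner power2_norm_eq_inner)
qed

lemma norm_scaleC: "norm (a *\<^sub>C x) = cmod a * norm x"
proof -
  have "cinner (a *\<^sub>C x) (a *\<^sub>C x) = (a * cnj a) * cinner x x"
    by (simp add: cinner_scaleC_left cinner_scaleC_right)
  also have "\<dots> = complex_of_real ((cmod a * norm x)\<^sup>2)"
    by (simp only: cinner_self power_mult_distrib of_real_mult complex_norm_square)
  finally have "cinner (a *\<^sub>C x) (a *\<^sub>C x) = complex_of_real ((cmod a * norm x)\<^sup>2)" .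
  then have "(norm (a *\<^sub>C x))\<^sup>2 = (cmod a * norm x)\<^sup>2"
    by (metis cinner_self of_real_eq_iff)
  then show ?thesis
    by (simp add: power2_eq_iff_nonneg)
qed

lemma norm_cinner_le: "cmod (cinner x y) \<le> norm x * norm y"
proof -
  let ?c = "cinner x y"
  \<comment> \<open>Rotating the first argument makes the inner product real, so the real Cauchy--Schwarz
    inequality applies.\<close>
  define u where "u = cnj (sgn ?c)"
  have "u * ?c = complex_of_real (cmod ?c)"
    by (simp add: u_def sgn_eq divide_simps complex_norm_square[symmetric] mult.commute power2_eq_square)
  then have "inner (u *\<^sub>C x) y = cmod ?c"
    by (simp add: inner_eq_Re_cinner cinner_scaleC_left)
  moreover have "norm (u *\<^sub>C x) \<le> norm x"
    by (simp add: norm_scaleC u_def norm_sgn)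
  ultimately show ?thesis
    by (metis norm_cauchy_schwarz mult_right_mono norm_ge_zero order_trans)
qed

interpretation cinner: bounded_bilinear "cinner :: 'a::complex_hilbert_space \<Rightarrow> 'a \<Rightarrow> complex"
proof
  show "\<exists>K. \<forall>a b::'a. cmod (cinner a b) \<le> norm a * norm b * K"
    by (rule exI[of _ 1]) (simp add: norm_cinner_le)
qed (simp_all add: cinner_add_left cinner_add_right cinner_scaleC_left cinner_scaleC_right
    scaleR_eq_scaleC scaleR_conv_of_real)

interpretation scaleC_bilinear: bounded_bilinear "scaleC :: complex \<Rightarrow> 'a::complex_hilbert_space \<Rightarrow> 'a"
proof
  show "\<exists>K. \<forall>a (b::'a). norm (a *\<^sub>C b) \<le> norm a * norm b * K"
    by (rule exI[of _ 1]) (simp add: norm_scaleC)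
qed (simp_all add: scaleC_add_left scaleC_add_right scaleC_scaleC
    scaleR_eq_scaleC scaleR_conv_of_real mult.commute)

lemma norm_add_orthogonal:
  assumes "cinner x y = 0"
  shows "(norm (x + y))\<^sup>2 = (norm x)\<^sup>2 + (norm y)\<^sup>2"
proof -
  have "inner x y = 0" using assms by (simp add: inner_eq_Re_cinner)
  then show ?thesis by (simp add: power2_norm_eq_inner inner_add inner_commute)
qed

definition orthogonal_to :: "'a::complex_hilbert_space \<Rightarrow> 'a set \<Rightarrow> bool" where
  "orthogonal_to x F \<longleftrightarrow> (\<forall>f\<in>F. cinner x f = 0)"

lemma orthogonal_to_Un: "orthogonal_to x (F \<union> G) \<longleftrightarrow> orthogonal_to x F \<and> orthogonal_to x G"
  by (auto simp: orthogonal_to_def)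

lemma orthogonal_complement_closed: "csubspace {x. orthogonal_to x F}" "closed {x. orthogonal_to x F}"
proof -
  show "csubspace {x. orthogonal_to x F}"
    by (auto simp: csubspace_def orthogonal_to_def cinner.add_left cinner_scaleC_left cinner.zero_left)
  have "{x. orthogonal_to x F} = (\<Inter>f\<in>F. {x. cinner x f = 0})"
    by (auto simp: orthogonal_to_def)
  moreover have "closed {x. cinner x f = 0}" for f :: 'a
    by (intro closed_Collect_eq continuous_intros cinner.continuous_on)
  ultimately show "closed {x. orthogonal_to x F}"
    by (auto intro: closed_INT)
qed

text \<open>The representing vector spans the orthogonal complement of the kernel.\<close>

lemma riesz_representation:
  fixes \<phi> :: "'a::complex_hilbert_space \<Rightarrow> complex"
  assumes bl: "bounded_linear \<phi>" and sc: "\<And>a x. \<phi> (a *\<^sub>C x) = a * \<phi> x"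
  shows "\<exists>f. \<forall>x. \<phi> x = cinner x f"
proof (cases "\<forall>x. \<phi> x = 0")
  case True
  then show ?thesis by (intro exI[of _ 0]) (simp add: cinner.zero_right)
next
  case False
  then obtain x0 where x0: "\<phi> x0 \<noteq> 0" by blast
  interpret bounded_linear \<phi> by (rule bl)
  let ?K = "{x. \<phi> x = 0}"
  have "csubspace ?K" by (auto simp: csubspace_def zero add sc)
  moreover have "closed ?K"
    by (intro closed_Collect_eq continuous_intros linear_continuous_on bl)
  ultimately obtain y where y: "\<phi> y = 0" "\<And>z. \<phi> z = 0 \<Longrightarrow> cinner (x0 - y) z = 0"
    using orth_proj_exists_unique[of ?K x0] by auto
  define v where "v = x0 - y"
  have v: "\<phi> v \<noteq> 0" using x0 y by (simp add: v_def diff)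
  then have "v \<noteq> 0" using zero by auto
  then have nv: "cinner v v \<noteq> 0" by (simp add: cinner_self)
  have "\<phi> x = cinner x (cnj (\<phi> v / cinner v v) *\<^sub>C v)" for x
  proof -
    have "\<phi> (x - (\<phi> x / \<phi> v) *\<^sub>C v) = 0" using v by (simp add: diff sc)
    from y(2)[OF this] have "cinner (x - (\<phi> x / \<phi> v) *\<^sub>C v) v = 0"
      by (metis cinner_commute complex_cnj_zero v_def)
    then have "cinner x v = \<phi> x / \<phi> v * cinner v v"
      by (simp add: cinner.diff_left cinner_scaleC_left)
    then show ?thesis using v nv by (simp add: cinner_scaleC_right)
  qed
  then show ?thesis by blast
qed

abbreviation bounded_operator :: "('a::complex_hilbert_space \<Rightarrow> 'a) \<Rightarrow> bool" where
  "bounded_operator f \<equiv> f \<in> bounded_operators UNIV"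

lemma bounded_operatorD:
  assumes "bounded_operator f"
  shows "bounded_linear f" "f (a *\<^sub>C x) = a *\<^sub>C f x"
    "f (x + y) = f x + f y" "f (x - y) = f x - f y" "f 0 = 0"
  using assms
  by (auto simp: bounded_operators_UNIV linear_add linear_diff linear_0 bounded_linear.linear)

lemma bounded_operator_bound:
  assumes "bounded_operator f"
  obtains M where "M > 0" "\<And>x. norm (f x) \<le> M * norm x"
  using bounded_linear.pos_bounded[OF bounded_operatorD(1)[OF assms]]
  by (metis mult.commute)

lemma bounded_operator_comp:
  assumes "bounded_operator f" "bounded_operator g"
  shows "bounded_operator (\<lambda>x. f (g x))"
  using assms by (auto simp: bounded_operators_UNIV intro: bounded_linear_compose)

lemma bounded_operator_id: "bounded_operator (\<lambda>x. x)"
  by (simp add: bounded_operators_UNIV bounded_linear_ident)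

lemma bounded_operator_diff:
  assumes "bounded_operator f" "bounded_operator g"
  shows "bounded_operator (\<lambda>x. f x - g x)"
  using assms
  by (auto simp: bounded_operators_UNIV scaleC.scale_right_diff_distrib intro: bounded_linear_sub)

lemma bounded_operator_scale:
  assumes "bounded_operator f"
  shows "bounded_operator (\<lambda>x. a *\<^sub>C f x)"
  using assms
  by (auto simp: bounded_operators_UNIV mult.commute scaleC_scaleC
      intro: bounded_linear_compose[OF scaleC_bilinear.bounded_linear_right])

lemma bounded_operator_rank_one: "bounded_operator (\<lambda>x. cinner x v *\<^sub>C a)"
  by (auto simp: bounded_operators_UNIV cinner_scaleC_left scaleC_scaleC
      intro!: bounded_linear_compose[OF scaleC_bilinear.bounded_linear_left] cinner.bounded_linear_left)

lemma bounded_operator_funpow: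
  assumes "bounded_operator f"
  shows "bounded_operator (f ^^ k)"
proof (induction k)
  case 0
  then show ?case by (simp add: id_def bounded_operator_id)
next
  case (Suc k)
  then show ?case using bounded_operator_comp[OF assms Suc] by (simp add: o_def)
qed

lemma adjoint_vector:
  assumes "bounded_operator A"
  shows "\<exists>g. \<forall>x. cinner (A x) f = cinner x g"
  by (intro riesz_representation bounded_linear_compose[OF cinner.bounded_linear_left]
      bounded_operatorD(1) assms)
    (simp add: bounded_operatorD[OF assms] cinner_scaleC_left)

lemma orthogonal_to_preimage:
  assumes "bounded_operator A" "finite F"
  obtains G where "finite G" "\<And>x. orthogonal_to x G \<Longrightarrow> orthogonal_to (A x) F"
proof -
  obtain g where "\<And>f x. cinner (A x) f = cinner x (g f)"
    using adjoint_vector[OF assms(1)] by metis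
  then show thesis
    by (intro that[of "g ` F"]) (auto simp: orthogonal_to_def assms)
qed

section \<open>Invertible operators and the resolvent\<close>

definition is_inverse :: "('a::complex_hilbert_space \<Rightarrow> 'a) \<Rightarrow> ('a \<Rightarrow> 'a) \<Rightarrow> bool" where
  "is_inverse S R \<longleftrightarrow> bounded_operator R \<and> (\<forall>x. R (S x) = x \<and> S (R x) = x)"

lemma op_spectrum_iff: "\<mu> \<notin> op_spectrum T \<longleftrightarrow> (\<exists>R. is_inverse (\<lambda>x. T x - \<mu> *\<^sub>C x) R)"
proof -
  have "R (T x - \<mu> *\<^sub>C x) = x \<and> T (R x) - \<mu> *\<^sub>C R x = x \<longleftrightarrow>
      R ((\<lambda>x. T x - \<mu> *\<^sub>C x) x) = x \<and> (\<lambda>x. T x - \<mu> *\<^sub>C x) (R x) = x" for R x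
    by simp
  then show ?thesis
    by (auto simp: op_spectrum_def is_inverse_def)
qed

lemma bounded_below_surjective_inverse:
  assumes S: "bounded_operator S"
    and surj: "\<And>y. \<exists>x. S x = y" and below: "\<And>x. norm x \<le> K * norm (S x)"
  obtains R where "is_inverse S R" "\<And>y. norm (R y) \<le> K * norm y"
proof -
  note S' = bounded_operatorD[OF S]
  obtain R where R: "\<And>y. S (R y) = y" using surj by metis
  have inj: "x = y" if "S x = S y" for x y
    using below[of "x - y"] that by (simp add: S')
  have RS: "R (S x) = x" for x by (rule inj) (rule R)
  have "bounded_operator R"
    unfolding bounded_operators_def clinear_on_def
  proof (intro CollectI conjI ballI allI)
    show "R (x + y) = R x + R y" for x y by (rule inj) (simp add: R S')
    show "R (a *\<^sub>C x) = a *\<^sub>C R x" for a x by (rule inj) (simp add: R S')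
    show "\<exists>M. \<forall>x\<in>UNIV. norm (R x) \<le> M * norm x"
      by (rule exI[of _ K]) (metis below R)
  qed auto
  then show thesis
    by (intro that[of R]) (auto simp: is_inverse_def R RS, metis below R)
qed

text \<open>The equation \<open>S x - B x = y\<close> is the fixed point equation \<open>x = R (y + B x)\<close>, and its right hand
  side is a contraction.\<close>

lemma inverse_perturbation:
  assumes S: "bounded_operator S" and R: "is_inverse S R" and B: "bounded_operator B"
    and c: "\<And>x. norm (R x) \<le> c * norm x"
    and q: "q < 1" "\<And>x. norm (R (B x)) \<le> q * norm x"
  obtains R' where "is_inverse (\<lambda>x. S x - B x) R'" "\<And>y. norm (R' y) \<le> c / (1 - q) * norm y"
proof (rule bounded_below_surjective_inverse[of "\<lambda>x. S x - B x" "c / (1 - q)"])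
  have R': "bounded_operator R" "R (S x) = x" "S (R x) = x" for x
    using R by (auto simp: is_inverse_def)
  note lin = bounded_operatorD[OF S] bounded_operatorD[OF R'(1)] bounded_operatorD[OF B]
  show "bounded_operator (\<lambda>x. S x - B x)"
    by (intro bounded_operator_diff S B)
  show "\<exists>x. S x - B x = y" for y
  proof -
    define f where "f x = R (y + B x)" for x
    have f: "f x - f z = R (B (x - z))" for x z
      by (simp add: f_def lin)
    have "dist (f x) (f z) \<le> max q 0 * dist x z" for x z
    proof -
      have "dist (f x) (f z) \<le> q * norm (x - z)"
        by (simp add: dist_norm f q)
      also have "\<dots> \<le> max q 0 * norm (x - z)"
        by (intro mult_right_mono) auto
      finally show ?thesis by (simp add: dist_norm)
    qed
    then obtain x where "f x = x"
      using banach_fix_type[of "max q 0" f] q by auto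
    then have "S x = y + B x"
      unfolding f_def by (metis R'(3))
    then show ?thesis by (intro exI[of _ x]) simp
  qed
  show "norm x \<le> c / (1 - q) * norm (S x - B x)" for x
  proof -
    have "x = R (S x - B x) + R (B x)"
      by (simp add: lin R')
    then have "norm x \<le> c * norm (S x - B x) + q * norm x"
      using norm_triangle_mono[OF c[of "S x - B x"] q(2)[of x]] by simp
    then show ?thesis using q by (simp add: field_simps)
  qed
qed (use that in auto)

text \<open>The Sherman--Morrison formula: if \<open>(S - \<langle>\<cdot>, v\<rangle> a) x = y\<close>, then \<open>\<langle>x, v\<rangle> (1 - \<langle>R a, v\<rangle>) = \<langle>R y, v\<rangle>\<close>, which
  determines \<open>x = R y + \<langle>x, v\<rangle> R a\<close>.\<close>

lemma rank_one_perturbation: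
  assumes S: "bounded_operator S" and R: "is_inverse S R" and g: "1 \<noteq> cinner (R a) v"
  obtains R' where "is_inverse (\<lambda>x. S x - cinner x v *\<^sub>C a) R'"
proof -
  have R': "bounded_operator R" "R (S x) = x" "S (R x) = x" for x
    using R by (auto simp: is_inverse_def)
  note lin = bounded_operatorD[OF S] bounded_operatorD[OF R'(1)]
  obtain c where c: "c > 0" "\<And>x. norm (R x) \<le> c * norm x"
    using bounded_operator_bound[OF R'(1)] by blast
  define g where "g = 1 - cinner (R a) v"
  have g0: "g \<noteq> 0" using g by (simp add: g_def)
  show thesis
  proof (rule bounded_below_surjective_inverse[of "\<lambda>x. S x - cinner x v *\<^sub>C a"
        "c + c * norm v / cmod g * norm (R a)"])
    show "bounded_operator (\<lambda>x. S x - cinner x v *\<^sub>C a)"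
      by (intro bounded_operator_diff S bounded_operator_rank_one)
    show "\<exists>x. S x - cinner x v *\<^sub>C a = y" for y
    proof -
      define x where "x = R y + (cinner (R y) v / g) *\<^sub>C R a"
      have "cinner x v = cinner (R y) v * (g + cinner (R a) v) / g"
        using g0 by (simp add: x_def cinner.add_left cinner_scaleC_left field_simps)
      then have "cinner x v = cinner (R y) v / g" by (simp add: g_def)
      then have "S x - cinner x v *\<^sub>C a = y"
        by (simp add: lin R' x_def)
      then show ?thesis by blast
    qed
    show "norm x \<le> (c + c * norm v / cmod g * norm (R a)) * norm (S x - cinner x v *\<^sub>C a)" for x
    proof -
      define y where "y = S x - cinner x v *\<^sub>C a"
      have x: "x = R y + cinner x v *\<^sub>C R a"
        by (simp add: y_def lin R')
      have "cinner (R y) v = cinner x v * g"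
        by (simp add: y_def lin R' g_def cinner.diff_left cinner_scaleC_left algebra_simps)
      then have "cmod (cinner x v) = cmod (cinner (R y) v) / cmod g"
        using g0 by (simp add: norm_mult)
      also have "\<dots> \<le> norm (R y) * norm v / cmod g"
        by (intro divide_right_mono norm_cinner_le) simp
      also have "\<dots> \<le> (c * norm y) * norm v / cmod g"
        by (intro divide_right_mono mult_right_mono c) simp_all
      finally have "cmod (cinner x v) * norm (R a) \<le> (c * norm y) * norm v / cmod g * norm (R a)"
        by (rule mult_right_mono) simp
      moreover have "norm x \<le> norm (R y) + cmod (cinner x v) * norm (R a)"
        using norm_triangle_ineq[of "R y" "cinner x v *\<^sub>C R a"] x by (simp add: norm_scaleC)
      ultimately have "norm x \<le> c * norm y + (c * norm y) * norm v / cmod g * norm (R a)"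
        using c(2)[of y] by linarith
      then show ?thesis by (simp add: y_def[symmetric] algebra_simps)
    qed
  qed (use that in auto)
qed

text \<open>The resolvent identity gives the difference quotients, and the bound on the perturbed inverse
  gives their limit.\<close>

lemma resolvent_holomorphic:
  fixes A :: "'a::complex_hilbert_space \<Rightarrow> 'a"
  assumes A: "bounded_operator A"
  defines "G \<equiv> {u. \<exists>R. is_inverse (\<lambda>x. x - u *\<^sub>C A x) R}"
  obtains R where "open G" "\<And>u. u \<in> G \<Longrightarrow> is_inverse (\<lambda>x. x - u *\<^sub>C A x) (R u)"
    "\<And>a v. (\<lambda>u. cinner (R u a) v) holomorphic_on G"
proof -
  define R where "R u = (SOME R. is_inverse (\<lambda>x. x - u *\<^sub>C A x) R)" for u
  have R: "is_inverse (\<lambda>x. x - u *\<^sub>C A x) (R u)" if "u \<in> G" for u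
    using that someI_ex[of "is_inverse (\<lambda>x. x - u *\<^sub>C A x)"] unfolding R_def G_def by blast
  have bo: "bounded_operator (\<lambda>x. x - u *\<^sub>C A x)" for u
    by (intro bounded_operator_diff bounded_operator_id bounded_operator_scale A)
  obtain K where K: "K > 0" "\<And>x. norm (A x) \<le> K * norm x"
    using bounded_operator_bound[OF A] by blast
  have uniq: "R' = R u" if "is_inverse (\<lambda>x. x - u *\<^sub>C A x) R'" "u \<in> G" for u R'
  proof
    fix x
    have "R' x = R u (R' x - u *\<^sub>C A (R' x))"
      using R[OF that(2)] unfolding is_inverse_def by metis
    also have "R' x - u *\<^sub>C A (R' x) = x"
      using that(1) unfolding is_inverse_def by metis
    finally show "R' x = R u x" .
  qed
  have local: "\<exists>c d. c > 0 \<and> d > 0 \<and> (\<forall>x. norm (R u0 x) \<le> c * norm x) \<and>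
      (\<forall>u\<in>ball u0 d. u \<in> G \<and> (\<forall>x. norm (R u x) \<le> c * norm x))" if u0: "u0 \<in> G" for u0
  proof -
    have R0: "bounded_operator (R u0)" using R[OF u0] by (simp add: is_inverse_def)
    obtain c where c: "c > 0" "\<And>x. norm (R u0 x) \<le> c * norm x"
      using bounded_operator_bound[OF R0] by blast
    define d where "d = 1 / (2 * c * K)"
    have d: "d > 0" using c K by (simp add: d_def)
    have "u \<in> G \<and> (\<forall>x. norm (R u x) \<le> 2 * c * norm x)" if "u \<in> ball u0 d" for u
    proof -
      have small: "cmod (u - u0) * (c * K) \<le> 1/2"
        using that c K by (simp add: d_def dist_norm norm_minus_commute field_simps)
      have "norm (R u0 ((u - u0) *\<^sub>C A x)) \<le> 1/2 * norm x" for x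
      proof -
        have "norm (R u0 ((u - u0) *\<^sub>C A x)) \<le> c * (cmod (u - u0) * norm (A x))"
          using c(2)[of "(u - u0) *\<^sub>C A x"] by (simp add: norm_scaleC)
        also have "\<dots> \<le> c * (cmod (u - u0) * (K * norm x))"
          using c by (intro mult_left_mono K) auto
        also have "\<dots> = cmod (u - u0) * (c * K) * norm x" by simp
        also have "\<dots> \<le> 1/2 * norm x" by (intro mult_right_mono small) simp
        finally show ?thesis .
      qed
      then obtain R' where R': "is_inverse (\<lambda>x. x - u0 *\<^sub>C A x - (u - u0) *\<^sub>C A x) R'"
          "\<And>y. norm (R' y) \<le> c / (1 - 1/2) * norm y"
        using inverse_perturbation[OF bo R[OF u0] bounded_operator_scale[OF A] c(2), of "1/2" "u - u0"]
        by (auto simp: field_simps)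
      have "is_inverse (\<lambda>x. x - u *\<^sub>C A x) R'"
        using R'(1) by (simp add: algebra_simps)
      moreover from this have "u \<in> G" by (auto simp: G_def)
      ultimately have "R' = R u" "u \<in> G" using uniq by auto
      with R'(2) show ?thesis by (simp add: mult.commute)
    qed
    moreover have "norm (R u0 x) \<le> 2 * c * norm x" for x
      using c(2)[of x] c(1) by (smt (verit) mult_right_mono norm_ge_zero)
    ultimately show ?thesis
      using c d by (intro exI[of _ "2 * c"] exI[of _ d]) auto
  qed
  have "open G"
    unfolding open_contains_ball using local by blast
  moreover have "(\<lambda>u. cinner (R u a) v) holomorphic_on G" for a v
    unfolding holomorphic_on_open[OF \<open>open G\<close>]
  proof
    fix u0 assume u0: "u0 \<in> G"
    obtain c d where cd: "c > 0" "d > 0" "\<And>x. norm (R u0 x) \<le> c * norm x"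
        "\<And>u. u \<in> ball u0 d \<Longrightarrow> u \<in> G" "\<And>u x. u \<in> ball u0 d \<Longrightarrow> norm (R u x) \<le> c * norm x"
      using local[OF u0] by blast
    have identity: "R u b - R u0 b = (u - u0) *\<^sub>C R u (A (R u0 b))" if "u \<in> ball u0 d" for u b
    proof -
      have Ru: "is_inverse (\<lambda>x. x - u *\<^sub>C A x) (R u)" "is_inverse (\<lambda>x. x - u0 *\<^sub>C A x) (R u0)"
        using R u0 cd(4)[OF that] by auto
      then have lin: "bounded_operator (R u)" by (simp add: is_inverse_def)
      have b: "b = R u0 b - u0 *\<^sub>C A (R u0 b)"
        using Ru(2) unfolding is_inverse_def by metis
      have "R u0 b = R u (R u0 b - u *\<^sub>C A (R u0 b))"
        using Ru(1) unfolding is_inverse_def by metis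
      then have "R u b - R u0 b = R u (b - (R u0 b - u *\<^sub>C A (R u0 b)))"
        by (simp add: bounded_operatorD[OF lin])
      also have "b - (R u0 b - u *\<^sub>C A (R u0 b)) = (u - u0) *\<^sub>C A (R u0 b)"
        by (subst b) (simp add: scaleC.scale_left_diff_distrib)
      finally show ?thesis by (simp add: bounded_operatorD[OF lin])
    qed
    have near: "eventually (\<lambda>u. u \<in> ball u0 d) (at u0)"
      using cd(2) by (intro eventually_at_in_open') auto
    have cont: "((\<lambda>u. cinner (R u b) v) \<longlongrightarrow> cinner (R u0 b) v) (at u0)" for b
    proof -
      have "((\<lambda>u. cinner (R u b) v - cinner (R u0 b) v) \<longlongrightarrow> 0) (at u0)"
      proof (rule Lim_null_comparison)
        show "\<forall>\<^sub>F u in at u0. cmod (cinner (R u b) v - cinner (R u0 b) v)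
            \<le> cmod (u - u0) * (c * norm (A (R u0 b)) * norm v)"
          using near
        proof eventually_elim
          case (elim u)
          have "cmod (cinner (R u b) v - cinner (R u0 b) v)
              \<le> norm (R u b - R u0 b) * norm v"
            by (metis cinner.diff_left norm_cinner_le)
          also have "\<dots> \<le> cmod (u - u0) * (c * norm (A (R u0 b))) * norm v"
            by (auto simp: identity[OF elim] norm_scaleC intro!: mult_right_mono mult_left_mono cd(5)[OF elim])
          finally show ?case by (simp add: mult.assoc)
        qed
        show "((\<lambda>u. cmod (u - u0) * (c * norm (A (R u0 b)) * norm v)) \<longlongrightarrow> 0) (at u0)"
          by (auto intro!: tendsto_eq_intros)
      qed
      then show ?thesis by (simp add: LIM_zero_iff)
    qed
    have "((\<lambda>u. cinner (R u a) v) has_field_derivative cinner (R u0 (A (R u0 a))) v) (at u0)"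
      unfolding has_field_derivative_iff
    proof (rule Lim_transform_eventually[OF cont])
      show "\<forall>\<^sub>F u in at u0. cinner (R u (A (R u0 a))) v
          = (cinner (R u a) v - cinner (R u0 a) v) / (u - u0)"
        using near eventually_neq_at_within[of u0]
      proof eventually_elim
        case (elim u)
        then show ?case
          by (simp add: identity cinner_scaleC_left flip: cinner.diff_left)
      qed
    qed
    then show "\<exists>f'. ((\<lambda>u. cinner (R u a) v) has_field_derivative f') (at u0)" by blast
  qed
  ultimately show thesis using R that by blast
qed

text \<open>An operator that is small on the orthogonal complement of a finite set is a finite rank
  perturbation of a small operator. The rank one summands are split off one at a time: where the
  resolvent \<open>R u\<close> of the remaining operator exists, the summand \<open>\<langle>\<cdot>, v\<rangle> A v\<close> destroys invertibility only
  at the zeros of the holomorphic function \<open>1 - u \<langle>R u (A v), v\<rangle>\<close>, which takes the value 1 at 0.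
  Removing countably many points from a disc leaves it connected, so these zeros are countable.\<close>

lemma countable_noninvertible:
  fixes A :: "'a::complex_hilbert_space \<Rightarrow> 'a"
  assumes "finite F" "bounded_operator A"
    and "\<And>x. orthogonal_to x F \<Longrightarrow> r * norm (A x) \<le> norm x"
  shows "countable {u \<in> ball 0 r. \<nexists>R. is_inverse (\<lambda>x. x - u *\<^sub>C A x) R}"
  using assms
proof (induction F arbitrary: A rule: finite_induct)
  case empty
  have "\<exists>R. is_inverse (\<lambda>x. x - u *\<^sub>C A x) R" if u: "u \<in> ball 0 r" for u
  proof -
    have r: "r > 0" using u by (metis dist_0_norm mem_ball norm_ge_zero order_le_less_trans)
    have id: "is_inverse (\<lambda>x::'a. x) (\<lambda>x. x)" by (simp add: is_inverse_def bounded_operator_id)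
    have bound: "norm (u *\<^sub>C A x) \<le> cmod u / r * norm x" for x
      using empty(2)[of x] r mult_left_mono[of "r * norm (A x)" "norm x" "cmod u"]
      by (simp add: norm_scaleC orthogonal_to_def field_simps)
    have lt: "cmod u / r < 1" using u r by simp
    have one: "norm x \<le> 1 * norm x" for x :: 'a by simp
    show ?thesis
      by (rule inverse_perturbation[OF bounded_operator_id id bounded_operator_scale[OF empty(1)]
            one lt bound]) (rule exI)
  qed
  then have "{u \<in> ball 0 r. \<nexists>R. is_inverse (\<lambda>x. x - u *\<^sub>C A x) R} = {}" by blast
  then show ?case by (simp only: countable_empty)
next
  case (insert f F)
  let ?K = "{x. orthogonal_to x F}"
  obtain f' where f': "orthogonal_to f' F" "\<And>z. orthogonal_to z F \<Longrightarrow> cinner (f - f') z = 0"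
    using orth_proj_exists_unique[OF orthogonal_complement_closed(1)[of F] orthogonal_complement_closed(2)[of F], of f] by auto
  have ff': "cinner x f = cinner x f'" if "orthogonal_to x F" for x
  proof -
    have "cinner x (f - f') = 0" using f'(2)[OF that] by (metis cinner_commute complex_cnj_zero)
    then show ?thesis by (simp add: cinner.diff_right)
  qed
  show ?case
  proof (cases "f' = 0")
    case True
    then have "r * norm (A x) \<le> norm x" if "orthogonal_to x F" for x
      using insert.prems(2)[of x] ff'[OF that] that
      by (simp add: orthogonal_to_def cinner.zero_right)
    then show ?thesis using insert.IH insert.prems(1) by blast
  next
    case False
    define v where "v = complex_of_real (1 / norm f') *\<^sub>C f'"
    have nv: "norm v = 1" using False by (simp add: v_def norm_scaleC norm_divide)
    then have vv: "cinner v v = 1" by (simp add: cinner_self)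
    have vF: "orthogonal_to v F"
      using f'(1) by (simp add: v_def orthogonal_to_def cinner_scaleC_left)
    define A' where "A' x = A (x - cinner x v *\<^sub>C v)" for x
    note lin = bounded_operatorD[OF insert.prems(1)]
    have A': "bounded_operator A'"
      unfolding A'_def
      by (intro bounded_operator_comp[OF insert.prems(1)] bounded_operator_diff
          bounded_operator_id bounded_operator_rank_one)
    have "r * norm (A' x) \<le> norm x" if x: "orthogonal_to x F" for x
    proof -
      define y where "y = x - cinner x v *\<^sub>C v"
      have yv: "cinner y v = 0"
        by (simp add: y_def cinner.diff_left cinner_scaleC_left vv)
      have yF: "orthogonal_to y F"
        using x vF by (simp add: y_def orthogonal_to_def cinner.diff_left cinner_scaleC_left)
      have "cinner y f' = 0"
        using yv False by (simp add: v_def cinner_scaleC_right)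
      then have "r * norm (A y) \<le> norm y"
        using yF ff'[OF yF] by (intro insert.prems(2)) (simp add: orthogonal_to_def)
      moreover have "norm y \<le> norm x"
      proof (rule power2_le_imp_le)
        have "cinner y (cinner x v *\<^sub>C v) = 0"
          by (simp add: cinner_scaleC_right yv)
        from norm_add_orthogonal[OF this]
        have "(norm x)\<^sup>2 = (norm y)\<^sup>2 + (norm (cinner x v *\<^sub>C v))\<^sup>2"
          by (simp add: y_def)
        then show "(norm y)\<^sup>2 \<le> (norm x)\<^sup>2" by simp
      qed simp
      ultimately show ?thesis by (simp add: A'_def y_def)
    qed
    note IH = insert.IH[OF A' this]
    define G where "G = {u. \<exists>R. is_inverse (\<lambda>x. x - u *\<^sub>C A' x) R}"
    obtain R where R: "open G" "\<And>u. u \<in> G \<Longrightarrow> is_inverse (\<lambda>x. x - u *\<^sub>C A' x) (R u)"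
        "\<And>a v. (\<lambda>u. cinner (R u a) v) holomorphic_on G"
      using resolvent_holomorphic[OF A'] unfolding G_def by blast
    define N where "N = {u \<in> ball 0 r. \<nexists>R. is_inverse (\<lambda>x. x - u *\<^sub>C A' x) R}"
    have N: "countable N" unfolding N_def by (rule IH)
    have D: "ball 0 r - N = ball 0 r \<inter> G" by (auto simp: N_def G_def)
    have conn: "connected (ball 0 r \<inter> G)"
      unfolding D[symmetric] by (rule connected_open_diff_countable) (auto simp: N)
    define h where "h u = 1 - u * cinner (R u (A v)) v" for u
    have hol: "h holomorphic_on (ball 0 r \<inter> G)"
      unfolding h_def by (intro holomorphic_intros holomorphic_on_subset[OF R(3)]) auto
    have opn: "open (ball 0 r \<inter> G)" using R(1) by auto
    have zeros: "countable {u \<in> ball 0 r \<inter> G. h u = 0}"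
    proof (cases "r > 0")
      case True
      have "0 \<in> G"
        using bounded_operator_id by (auto simp: G_def is_inverse_def intro!: exI[of _ "\<lambda>x. x"])
      then have 0: "0 \<in> ball 0 r \<inter> G" using True by simp
      show ?thesis
      proof (cases "h constant_on (ball 0 r \<inter> G)")
        case const: True
        have "h u = 1" if "u \<in> ball 0 r \<inter> G" for u
        proof -
          have "h u = h 0" using const 0 that unfolding constant_on_def by metis
          then show ?thesis by (simp add: h_def)
        qed
        then have "{u \<in> ball 0 r \<inter> G. h u = 0} = {}" by force
        then show ?thesis by (metis countable_empty)
      next
        case False
        obtain C :: "nat \<Rightarrow> complex set" where "\<And>n. compact (C n)" "\<Union> (range C) = ball 0 r \<inter> G"
          using open_Union_compact_subsets[OF opn] by metis
        then have "fsigma (ball 0 r \<inter> G)" by (auto simp: fsigma_Union_compact)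
        with False show ?thesis
          by (intro holomorphic_countable_zeros hol opn conn)
      qed
    next
      case False
      then have "{u \<in> ball 0 r \<inter> G. h u = 0} = {}"
        by (auto dest: le_less_trans[OF norm_ge_zero])
      then show ?thesis by (metis countable_empty)
    qed
    have "{u \<in> ball 0 r. \<nexists>R. is_inverse (\<lambda>x. x - u *\<^sub>C A x) R} \<subseteq> N \<union> {u \<in> ball 0 r \<inter> G. h u = 0}"
    proof
      fix u assume "u \<in> {u \<in> ball 0 r. \<nexists>R. is_inverse (\<lambda>x. x - u *\<^sub>C A x) R}"
      then have u: "u \<in> ball 0 r" "\<nexists>R. is_inverse (\<lambda>x. x - u *\<^sub>C A x) R" by simp_all
      show "u \<in> N \<union> {u \<in> ball 0 r \<inter> G. h u = 0}"
      proof (rule ccontr)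
        assume "u \<notin> N \<union> {u \<in> ball 0 r \<inter> G. h u = 0}"
        with u have uG: "u \<in> G" and hu: "h u \<noteq> 0" by (auto simp: N_def G_def)
        have Ru: "bounded_operator (R u)" using R(2)[OF uG] by (simp add: is_inverse_def)
        have "1 \<noteq> cinner (R u (u *\<^sub>C A v)) v"
          using hu by (simp add: h_def bounded_operatorD[OF Ru] cinner_scaleC_left)
        then obtain R' where "is_inverse (\<lambda>x. x - u *\<^sub>C A' x - cinner x v *\<^sub>C u *\<^sub>C A v) R'"
          by (rule rank_one_perturbation[OF
                bounded_operator_diff[OF bounded_operator_id bounded_operator_scale[OF A']] R(2)[OF uG]])
        moreover have "x - u *\<^sub>C A' x - cinner x v *\<^sub>C u *\<^sub>C A v = x - u *\<^sub>C A x" for x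
          by (simp add: A'_def lin scaleC.scale_right_diff_distrib scaleC_scaleC mult.commute)
        ultimately have "is_inverse (\<lambda>x. x - u *\<^sub>C A x) R'" by (simp only:)
        then show False using u(2) by blast
      qed
    qed
    then show ?thesis
      by (rule countable_subset) (use N zeros in auto)
  qed
qed

section \<open>Approximate eigenvectors and the polynomial hull\<close>

text \<open>For a bounded operator on a Hilbert space this is the left essential spectrum.\<close>

definition approx_ess_spectrum :: "('a::complex_hilbert_space \<Rightarrow> 'a) \<Rightarrow> complex set" where
  "approx_ess_spectrum T = {\<mu>. \<forall>F e. finite F \<longrightarrow> e > 0 \<longrightarrow>
     (\<exists>x. norm x = 1 \<and> orthogonal_to x F \<and> norm (T x - \<mu> *\<^sub>C x) < e)}"

lemma not_approx_ess_spectrumD: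
  fixes T :: "'a::complex_hilbert_space \<Rightarrow> 'a"
  assumes T: "bounded_operator T" and mu: "\<mu> \<notin> approx_ess_spectrum T"
  obtains F e where "finite F" "e > 0"
    "\<And>x. orthogonal_to x F \<Longrightarrow> e * norm x \<le> norm (T x - \<mu> *\<^sub>C x)"
proof -
  obtain F e where F: "finite F" "e > 0" and
    *: "\<And>x. norm x = 1 \<Longrightarrow> orthogonal_to x F \<Longrightarrow> e \<le> norm (T x - \<mu> *\<^sub>C x)"
    using mu unfolding approx_ess_spectrum_def by (auto simp: not_less)
  have "e * norm x \<le> norm (T x - \<mu> *\<^sub>C x)" if x: "orthogonal_to x F" for x
  proof (cases "x = 0")
    case False
    define a where "a = complex_of_real (1 / norm x)"
    have "e \<le> norm (T (a *\<^sub>C x) - \<mu> *\<^sub>C (a *\<^sub>C x))"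
      using False x by (intro *) (auto simp: a_def norm_scaleC norm_divide orthogonal_to_def cinner_scaleC_left)
    also have "T (a *\<^sub>C x) - \<mu> *\<^sub>C (a *\<^sub>C x) = a *\<^sub>C (T x - \<mu> *\<^sub>C x)"
      by (simp add: bounded_operatorD[OF T] scaleC.scale_right_diff_distrib mult.commute)
    finally have "e \<le> cmod a * norm (T x - \<mu> *\<^sub>C x)"
      by (simp only: norm_scaleC)
    then show ?thesis using False by (simp add: a_def norm_divide field_simps)
  qed simp
  then show thesis using F that by blast
qed

lemma op_spectrum_bounded:
  fixes T :: "'a::complex_hilbert_space \<Rightarrow> 'a"
  assumes T: "bounded_operator T"
  obtains K where "op_spectrum T \<subseteq> cball 0 K"
proof -
  obtain K where K: "K > 0" "\<And>x. norm (T x) \<le> K * norm x"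
    using bounded_operator_bound[OF T] by blast
  have "\<mu> \<notin> op_spectrum T" if mu: "cmod \<mu> > K" for \<mu>
  proof -
    have mu0: "\<mu> \<noteq> 0" "cmod \<mu> > 0" using mu K by auto
    let ?S = "\<lambda>x::'a. (- \<mu>) *\<^sub>C x" and ?R = "\<lambda>x::'a. (- 1 / \<mu>) *\<^sub>C x"
    have S: "bounded_operator ?S" "bounded_operator ?R"
      by (rule bounded_operator_scale[OF bounded_operator_id])+
    have B: "bounded_operator (\<lambda>x. (-1) *\<^sub>C T x)" by (rule bounded_operator_scale[OF T])
    have inv: "is_inverse ?S ?R" using mu0 S(2) by (simp add: is_inverse_def)
    have "norm (?R ((-1) *\<^sub>C T x)) \<le> K / cmod \<mu> * norm x" for x
      using K(2)[of x] mu0(2) by (simp add: norm_scaleC norm_divide field_simps)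
    moreover have "norm (?R x) \<le> 1 / cmod \<mu> * norm x" for x
      by (simp add: norm_scaleC norm_divide)
    moreover have "K / cmod \<mu> < 1" using mu mu0 by simp
    ultimately obtain R' where "is_inverse (\<lambda>x. ?S x - (-1) *\<^sub>C T x) R'"
      using inverse_perturbation[OF S(1) inv B] by metis
    then show ?thesis by (auto simp: op_spectrum_iff scaleC.scale_minus_left)
  qed
  then have "op_spectrum T \<subseteq> cball 0 K" by (force simp: not_less[symmetric])
  then show thesis by (rule that)
qed

text \<open>Arbitrarily near \<open>z\<close> there is \<open>w\<close> in the unbounded part of the resolvent set. The inverse of
  \<open>T - w\<close> is, up to a finite rank operator, bounded by a constant that does not depend on the distance
  from \<open>w\<close> to \<open>z\<close>, so all but countably many points of a disc around \<open>w\<close> that contains \<open>z\<close> are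
  outside the spectrum.\<close>

lemma outside_spectrum_dense_near:
  fixes T :: "'a::complex_hilbert_space \<Rightarrow> 'a"
  assumes T: "bounded_operator T" and z: "z \<notin> approx_ess_spectrum T"
    and zcl: "z \<in> closure (outside (op_spectrum T))"
  shows "z \<in> interior (closure (outside (op_spectrum T)))"
proof -
  let ?O = "outside (op_spectrum T)"
  obtain F e where F: "finite F" "e > 0"
    and below: "\<And>x. orthogonal_to x F \<Longrightarrow> e * norm x \<le> norm (T x - z *\<^sub>C x)"
    using not_approx_ess_spectrumD[OF T z] by blast
  obtain w where w: "w \<in> ?O" "dist w z < e / 4"
    using zcl F(2) by (meson closure_approachable divide_pos_pos zero_less_numeral)
  have "w \<notin> op_spectrum T" using w(1) outside_no_overlap by blast
  then obtain A where inv: "is_inverse (\<lambda>x. T x - w *\<^sub>C x) A"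
    by (auto simp: op_spectrum_iff)
  then have A: "bounded_operator A" and inv': "\<And>x. A (T x - w *\<^sub>C x) = x"
    "\<And>x. T (A x) - w *\<^sub>C A x = x"
    by (auto simp: is_inverse_def)
  obtain G where G: "finite G" "\<And>x. orthogonal_to x G \<Longrightarrow> orthogonal_to (A x) F"
    using orthogonal_to_preimage[OF A F(1)] by blast
  \<comment> \<open>Moving from \<open>z\<close> to \<open>w\<close> costs a quarter of the lower bound \<open>e\<close>.\<close>
  define r where "r = 3/4 * e"
  have r: "r * norm (A y) \<le> norm y" if y: "orthogonal_to y G" for y
  proof -
    have "T (A y) - z *\<^sub>C A y = y + (w - z) *\<^sub>C A y"
      using inv'(2)[of y] by (simp add: scaleC.scale_left_diff_distrib algebra_simps)
    then have "e * norm (A y) \<le> norm (y + (w - z) *\<^sub>C A y)"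
      using below[OF G(2)[OF y]] by simp
    also have "\<dots> \<le> norm y + cmod (w - z) * norm (A y)"
      using norm_triangle_ineq[of y "(w - z) *\<^sub>C A y"] by (simp add: norm_scaleC)
    also have "\<dots> \<le> norm y + e / 4 * norm (A y)"
      using w(2) by (intro add_left_mono mult_right_mono) (auto simp: dist_norm)
    finally show ?thesis by (simp add: r_def algebra_simps)
  qed
  let ?N = "{u \<in> ball 0 r. \<nexists>R. is_inverse (\<lambda>x. x - u *\<^sub>C A x) R}"
  have N: "countable ?N" by (rule countable_noninvertible[OF G(1) A r])
  have "op_spectrum T \<inter> ball w r \<subseteq> (\<lambda>u. w + u) ` ?N"
  proof
    fix y assume y: "y \<in> op_spectrum T \<inter> ball w r"
    have "y - w \<in> ?N"
    proof (rule ccontr)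
      assume "y - w \<notin> ?N"
      with y obtain R where R: "is_inverse (\<lambda>x. x - (y - w) *\<^sub>C A x) R"
        by (auto simp: dist_norm norm_minus_commute)
      have Ro: "bounded_operator R" using R by (simp add: is_inverse_def)
      \<comment> \<open>\<open>T - y\<close> is the product of \<open>1 - (y - w) A\<close> and \<open>T - w\<close>.\<close>
      have fact: "T x - y *\<^sub>C x = (T x - w *\<^sub>C x) - (y - w) *\<^sub>C A (T x - w *\<^sub>C x)" for x
        by (simp add: inv' scaleC.scale_left_diff_distrib)
      have "is_inverse (\<lambda>x. T x - y *\<^sub>C x) (\<lambda>x. A (R x))"
        unfolding is_inverse_def
      proof (intro conjI allI)
        show "bounded_operator (\<lambda>x. A (R x))" by (rule bounded_operator_comp[OF A Ro])
        have R': "R (v - (y - w) *\<^sub>C A v) = v" "R v - (y - w) *\<^sub>C A (R v) = v" for v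
          using R by (auto simp: is_inverse_def)
        show "A (R (T x - y *\<^sub>C x)) = x" for x
          by (simp only: fact R'(1)) (simp only: inv')
        show "T (A (R x)) - y *\<^sub>C A (R x) = x" for x
          by (simp only: fact inv'(2) R'(2))
      qed
      then show False using y op_spectrum_iff by blast
    qed
    then show "y \<in> (\<lambda>u. w + u) ` ?N" by (rule rev_image_eqI) simp
  qed
  then have cnt: "countable (op_spectrum T \<inter> ball w r)"
    using N by (meson countable_image countable_subset)
  have r0: "r > 0" using F(2) by (simp add: r_def)
  have "ball w r - op_spectrum T \<subseteq> ?O"
  proof
    fix y assume y: "y \<in> ball w r - op_spectrum T"
    have "connected (ball w r - (op_spectrum T \<inter> ball w r))"
      by (rule connected_open_diff_countable) (auto simp: cnt)
    moreover have "ball w r - (op_spectrum T \<inter> ball w r) = ball w r - op_spectrum T"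
      by blast
    ultimately have "connected (ball w r - op_spectrum T)" by simp
    then have "connected_component (- op_spectrum T) w y"
      unfolding connected_component_def
      using y \<open>w \<notin> op_spectrum T\<close> r0 by (intro exI[of _ "ball w r - op_spectrum T"]) auto
    then show "y \<in> ?O" using w(1) by (rule outside_same_component)
  qed
  moreover have "ball w r \<subseteq> closure (ball w r - op_spectrum T)"
  proof
    fix y assume y: "y \<in> ball w r"
    show "y \<in> closure (ball w r - op_spectrum T)"
      unfolding closure_approachable
    proof (intro allI impI)
      fix d :: real assume d: "d > 0"
      have "open (ball w r \<inter> ball y d)" "ball w r \<inter> ball y d \<noteq> {}"
        using y d by auto
      then obtain b \<delta> where b: "\<delta> > 0" "ball b \<delta> \<subseteq> ball w r \<inter> ball y d"
        by (metis all_not_in_conv open_contains_ball)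
      then have "uncountable (ball w r \<inter> ball y d)"
        using countable_subset uncountable_ball by blast
      then have "\<not> ball w r \<inter> ball y d \<subseteq> op_spectrum T \<inter> ball w r"
        using cnt countable_subset by blast
      then obtain x where "x \<in> ball w r - op_spectrum T" "x \<in> ball y d"
        by blast
      then show "\<exists>x\<in>ball w r - op_spectrum T. dist x y < d"
        by (intro bexI[of _ x]) (auto simp: dist_commute)
    qed
  qed
  ultimately have "ball w r \<subseteq> closure ?O"
    using closure_mono by blast
  moreover have "z \<in> ball w r" using w(2) F(2) by (simp add: r_def)
  ultimately show ?thesis
    by (meson interiorI open_ball)
qed

text \<open>Suppose that the real part of \<open>p\<close> does not exceed \<open>Re (p \<zeta>)\<close> on the approximate essential
  spectrum. The set \<open>{z. Re (p z) > Re (p \<zeta>)}\<close> then avoids that spectrum, meets the disc by the open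
  mapping theorem, and has unbounded components by the maximum principle. In such a component the
  closure of the unbounded part of the resolvent set is nonempty, relatively closed and, by the
  preceding lemma, relatively open. So it fills the component, and points outside the polynomial hull
  of the spectrum appear in the disc.\<close>

lemma approx_ess_spectrum_exceeds:
  fixes T :: "'a::complex_hilbert_space \<Rightarrow> 'a" and p :: "complex \<Rightarrow> complex"
  assumes T: "bounded_operator T"
    and hull: "ball 0 1 \<subseteq> polynomial_hull (op_spectrum T)"
    and hol: "p holomorphic_on UNIV" and nonconst: "\<not> p constant_on UNIV"
    and lam: "\<zeta> \<in> ball 0 1"
  shows "\<exists>\<mu>\<in>approx_ess_spectrum T. Re (p \<mu>) > Re (p \<zeta>)"
proof (rule ccontr)
  assume neg: "\<not> ?thesis"
  let ?O = "outside (op_spectrum T)"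
  define c where "c = Re (p \<zeta>)"
  define \<Omega> where "\<Omega> = {z. Re (p z) > c}"
  have contp: "continuous_on UNIV p" using hol by (rule holomorphic_on_imp_continuous_on)
  have \<Omega>_open: "open \<Omega>"
    unfolding \<Omega>_def by (intro open_Collect_less continuous_intros contp)
  have \<Omega>_disj: "z \<notin> approx_ess_spectrum T" if "z \<in> \<Omega>" for z
    using neg that by (auto simp: \<Omega>_def c_def)
  have "open (p ` ball 0 1)"
    by (rule open_mapping_thm[OF hol open_UNIV connected_UNIV _ _ nonconst]) auto
  then obtain e where e: "e > 0" "ball (p \<zeta>) e \<subseteq> p ` ball 0 1"
    using lam open_contains_ball by blast
  have "p \<zeta> + complex_of_real (e/2) \<in> ball (p \<zeta>) e" using e(1) by (simp add: dist_norm)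
  then obtain z0 where z0: "z0 \<in> ball 0 1" "p z0 = p \<zeta> + complex_of_real (e/2)"
    using e(2) by (metis imageE subsetD)
  then have "z0 \<in> \<Omega>" using e(1) by (simp add: \<Omega>_def c_def)
  define W where "W = connected_component_set \<Omega> z0"
  have W: "open W" "connected W" "z0 \<in> W" "W \<subseteq> \<Omega>"
    using \<Omega>_open \<open>z0 \<in> \<Omega>\<close> by (auto simp: W_def open_connected_component connected_component_subset)
  have "\<not> bounded W"
  proof
    assume bdd: "bounded W"
    have "Re (p z) \<le> c" if z: "z \<in> frontier W" for z
    proof (rule ccontr)
      assume "\<not> Re (p z) \<le> c"
      then have "z \<in> \<Omega>" by (simp add: \<Omega>_def)
      have "connected (insert z W)"
      proof (rule connected_intermediate_closure[OF W(2)])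
        show "W \<subseteq> insert z W" by blast
        show "insert z W \<subseteq> closure W"
          using z closure_subset[of W] unfolding frontier_def by blast
      qed
      then have "insert z W \<subseteq> connected_component_set \<Omega> z0"
        using W \<open>z \<in> \<Omega>\<close> by (intro connected_component_maximal) auto
      then have "z \<in> W" by (simp add: W_def)
      then show False using z W(1) by (simp add: frontier_def interior_open)
    qed
    then have "Re (p z0) \<le> c"
      using maximum_real_frontier[of p W c z0] W bdd holomorphic_on_subset[OF hol]
        continuous_on_subset[OF contp] by auto
    then show False using \<open>z0 \<in> \<Omega>\<close> by (simp add: \<Omega>_def)
  qed
  obtain K where K: "op_spectrum T \<subseteq> cball 0 K"
    using op_spectrum_bounded[OF T] by blast
  have "- cball 0 K \<subseteq> ?O"
    using outside_mono[OF K] by (simp add: outside_convex)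
  moreover obtain y where y: "y \<in> W" "y \<notin> cball 0 K"
    using \<open>\<not> bounded W\<close> by (meson bounded_cball bounded_subset subsetI)
  ultimately have "y \<in> closure ?O" using closure_subset by blast
  then have ne: "W \<inter> closure ?O \<noteq> {}" using y by blast
  have eq: "W \<inter> closure ?O = W \<inter> interior (closure ?O)"
    using outside_spectrum_dense_near[OF T \<Omega>_disj] W(4) interior_subset by blast
  have "W \<inter> closure ?O = W"
  proof -
    have "openin (top_of_set W) (W \<inter> closure ?O)"
      unfolding eq by (rule openin_open_Int) simp
    moreover have "closedin (top_of_set W) (W \<inter> closure ?O)"
      by (rule closedin_closed_Int) simp
    ultimately show ?thesis
      using W(2) ne unfolding connected_clopen by blast
  qed
  then have "z0 \<in> closure ?O" using W(3) by blast
  then have "ball 0 1 \<inter> ?O \<noteq> {}"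
    using z0(1) open_Int_closure_eq_empty[OF open_ball, of 0 1 ?O] by blast
  moreover have "polynomial_hull (op_spectrum T) \<inter> ?O = {}"
  proof -
    have "x \<notin> ?O" if "U \<in> components (- op_spectrum T)" "bounded U" "x \<in> U" for x U
    proof -
      have "connected_component_set (- op_spectrum T) x = U"
        using that(1,3) by (metis components_iff connected_component_eq)
      then show ?thesis using that(2) by (simp add: outside)
    qed
    then show ?thesis
      using outside_no_overlap[of "op_spectrum T"] unfolding polynomial_hull_def by blast
  qed
  ultimately show False using hull by blast
qed

section \<open>Vectors with prescribed moments\<close>

text \<open>Each vector is chosen orthogonal to the images of the previous ones under \<open>T ^^ k\<close> and its
  adjoint, a finite set.\<close>

lemma orthogonal_orbit_sequence:
  fixes T :: "'a::complex_hilbert_space \<Rightarrow> 'a" and P :: "nat \<Rightarrow> 'a \<Rightarrow> bool"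
  assumes T: "bounded_operator T"
    and ex: "\<And>j F. finite F \<Longrightarrow> \<exists>x. orthogonal_to x F \<and> P j x"
  obtains x where "\<forall>j. P j (x j)"
    "\<forall>i j k. i \<noteq> j \<longrightarrow> k \<le> n \<longrightarrow> cinner ((T ^^ k) (x i)) (x j) = 0"
proof -
  have "\<forall>k f. \<exists>g. \<forall>x. cinner ((T ^^ k) x) f = cinner x g"
    using adjoint_vector[OF bounded_operator_funpow[OF T]] by blast
  then obtain g where g: "\<And>k f x. cinner ((T ^^ k) x) f = cinner x (g k f)"
    by metis
  let ?Q = "\<lambda>f j r. P j r \<and> (\<forall>i<j. \<forall>k\<le>n. cinner ((T ^^ k) r) (f i) = 0 \<and> cinner ((T ^^ k) (f i)) r = 0)"
  have "\<exists>x. \<forall>j. ?Q x j (x j)"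
  proof (rule dependent_wellorder_choice)
    show "\<exists>r. ?Q f j r" for f j
    proof -
      define F where "F = (\<lambda>(i,k). g k (f i)) ` ({..<j} \<times> {..n}) \<union> (\<lambda>(i,k). (T ^^ k) (f i)) ` ({..<j} \<times> {..n})"
      have "finite F" by (simp add: F_def)
      from ex[OF this] obtain r where r: "orthogonal_to r F" "P j r" by blast
      have "cinner ((T ^^ k) r) (f i) = 0 \<and> cinner ((T ^^ k) (f i)) r = 0" if "i < j" "k \<le> n" for i k
      proof -
        have "g k (f i) \<in> F" "(T ^^ k) (f i) \<in> F" using that by (auto simp: F_def)
        then have "cinner r (g k (f i)) = 0" "cinner r ((T ^^ k) (f i)) = 0"
          using r(1) by (auto simp: orthogonal_to_def)
        then show ?thesis using g cinner_commute[of "(T ^^ k) (f i)" r] by simp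
      qed
      with r(2) show ?thesis by blast
    qed
  qed auto
  then obtain x where "\<forall>j. ?Q x j (x j)" by (elim exE)
  then have x: "\<And>j. P j (x j)" "\<And>i j k. i < j \<Longrightarrow> k \<le> n \<Longrightarrow>
      cinner ((T ^^ k) (x j)) (x i) = 0 \<and> cinner ((T ^^ k) (x i)) (x j) = 0"
    by simp_all
  have "cinner ((T ^^ k) (x i)) (x j) = 0" if "i \<noteq> j" "k \<le> n" for i j k
    using x(2) that by (metis nat_neq_iff)
  with x(1) show thesis by (intro that) auto
qed

lemma cinner_sum_orthogonal:
  fixes S :: "'a::complex_hilbert_space \<Rightarrow> 'a"
  assumes S: "bounded_operator S" and J: "finite J"
    and orth: "\<And>i j. i \<in> J \<Longrightarrow> j \<in> J \<Longrightarrow> i \<noteq> j \<Longrightarrow> cinner (S (x i)) (x j) = 0"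
  shows "cinner (S (\<Sum>j\<in>J. c j *\<^sub>C x j)) (\<Sum>j\<in>J. d j *\<^sub>C x j)
    = (\<Sum>j\<in>J. c j * cnj (d j) * cinner (S (x j)) (x j))"
proof -
  have "S (\<Sum>j\<in>J. c j *\<^sub>C x j) = (\<Sum>j\<in>J. c j *\<^sub>C S (x j))"
    using bounded_linear.linear[OF bounded_operatorD(1)[OF S]]
    by (simp add: linear_sum bounded_operatorD(2)[OF S])
  then have "cinner (S (\<Sum>j\<in>J. c j *\<^sub>C x j)) (\<Sum>j\<in>J. d j *\<^sub>C x j)
    = (\<Sum>i\<in>J. \<Sum>j\<in>J. c i * cnj (d j) * cinner (S (x i)) (x j))"
    by (simp only: cinner.sum_left) (simp add: cinner.sum_right cinner_scaleC_left cinner_scaleC_right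
        sum_distrib_left mult_ac)
  also have "\<dots> = (\<Sum>i\<in>J. \<Sum>j\<in>J. if i = j then c j * cnj (d j) * cinner (S (x j)) (x j) else 0)"
    using orth by (intro sum.cong refl) auto
  also have "\<dots> = (\<Sum>j\<in>J. c j * cnj (d j) * cinner (S (x j)) (x j))"
    using J by simp
  finally show ?thesis .
qed

lemma approx_eigenvector_power:
  fixes T :: "'a::complex_hilbert_space \<Rightarrow> 'a"
  assumes T: "bounded_operator T"
  obtains K where "K > 0"
    "\<And>k x. k \<le> n \<Longrightarrow> norm x = 1 \<Longrightarrow> cmod (cinner ((T ^^ k) x) x - \<mu> ^ k) \<le> K * norm (T x - \<mu> *\<^sub>C x)"
proof -
  obtain M where M: "M > 0" "\<And>x. norm (T x) \<le> M * norm x"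
    using bounded_operator_bound[OF T] by blast
  have "\<exists>K\<ge>0. \<forall>x. norm ((T ^^ k) x - \<mu> ^ k *\<^sub>C x) \<le> K * norm (T x - \<mu> *\<^sub>C x)" for k
  proof (induction k)
    case 0
    then show ?case by (intro exI[of _ 0]) simp
  next
    case (Suc k)
    then obtain K where K: "K \<ge> 0" "\<And>x. norm ((T ^^ k) x - \<mu> ^ k *\<^sub>C x) \<le> K * norm (T x - \<mu> *\<^sub>C x)"
      by blast
    have "norm ((T ^^ Suc k) x - \<mu> ^ Suc k *\<^sub>C x) \<le> (M * K + cmod \<mu> ^ k) * norm (T x - \<mu> *\<^sub>C x)" for x
    proof -
      have "(T ^^ Suc k) x - \<mu> ^ Suc k *\<^sub>C x
          = T ((T ^^ k) x - \<mu> ^ k *\<^sub>C x) + \<mu> ^ k *\<^sub>C (T x - \<mu> *\<^sub>C x)"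
        by (simp add: bounded_operatorD[OF T] scaleC.scale_right_diff_distrib mult.commute)
      then have "norm ((T ^^ Suc k) x - \<mu> ^ Suc k *\<^sub>C x)
          \<le> norm (T ((T ^^ k) x - \<mu> ^ k *\<^sub>C x)) + norm (\<mu> ^ k *\<^sub>C (T x - \<mu> *\<^sub>C x))"
        by (metis norm_triangle_ineq)
      also have "\<dots> \<le> M * (K * norm (T x - \<mu> *\<^sub>C x)) + cmod \<mu> ^ k * norm (T x - \<mu> *\<^sub>C x)"
        using M K(2)[of x] order_trans[OF M(2) mult_left_mono[OF K(2)[of x]]]
        by (intro add_mono) (auto simp: norm_scaleC norm_power)
      finally show ?thesis by (simp add: algebra_simps)
    qed
    moreover have "M * K + cmod \<mu> ^ k \<ge> 0" using M K by simp
    ultimately show ?case by blast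
  qed
  then obtain K where K: "\<And>k. K k \<ge> 0"
    "\<And>k x. norm ((T ^^ k) x - \<mu> ^ k *\<^sub>C x) \<le> K k * norm (T x - \<mu> *\<^sub>C x)"
    by metis
  define L where "L = 1 + (\<Sum>k\<le>n. K k)"
  have "cmod (cinner ((T ^^ k) x) x - \<mu> ^ k) \<le> L * norm (T x - \<mu> *\<^sub>C x)" if k: "k \<le> n" and x: "norm x = 1" for k x
  proof -
    have "cinner ((T ^^ k) x) x - \<mu> ^ k = cinner ((T ^^ k) x - \<mu> ^ k *\<^sub>C x) x"
      by (simp add: cinner.diff_left cinner_scaleC_left cinner_self x)
    then have "cmod (cinner ((T ^^ k) x) x - \<mu> ^ k) \<le> norm ((T ^^ k) x - \<mu> ^ k *\<^sub>C x)"
      using norm_cinner_le[of "(T ^^ k) x - \<mu> ^ k *\<^sub>C x" x] x by simp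
    also have "\<dots> \<le> K k * norm (T x - \<mu> *\<^sub>C x)" by (rule K)
    also have "K k \<le> (\<Sum>k\<le>n. K k)" using K(1) k by (intro member_le_sum) auto
    then have "K k * norm (T x - \<mu> *\<^sub>C x) \<le> L * norm (T x - \<mu> *\<^sub>C x)"
      by (intro mult_right_mono) (auto simp: L_def)
    finally show ?thesis .
  qed
  moreover have "L > 0" using K(1) by (simp add: L_def add_pos_nonneg sum_nonneg)
  ultimately show thesis by (rule that[rotated])
qed

lemma compact_box:
  fixes S :: "'i \<Rightarrow> 'a::topological_space set"
  assumes "\<And>i. compact (S i)"
  shows "compact {f. \<forall>i. f i \<in> S i}"
proof -
  have "compactin (product_topology (\<lambda>_. euclidean) UNIV) (PiE UNIV S)"
    using assms by (auto simp: compactin_PiE)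
  then show ?thesis
    by (simp add: euclidean_product_topology PiE_UNIV_domain flip: compactin_euclidean_iff)
       (simp add: Pi_def)
qed

text \<open>A theorem of the alternative: points that no linear functional separates strictly from 0 have 0
  in their convex hull. A shortest convex combination \<open>w\<close> exists by compactness, and if it were
  not 0, moving it towards a point on which the functional \<open>-w\<close> is positive would shorten it.\<close>

lemma zero_in_convex_hull:
  fixes v :: "'j \<Rightarrow> 'k \<Rightarrow> complex"
  assumes J: "finite J" "J \<noteq> {}" and K: "finite K"
    and alt: "\<And>a. \<exists>k\<in>K. a k \<noteq> 0 \<Longrightarrow> \<exists>j\<in>J. Re (\<Sum>k\<in>K. a k * v j k) > 0"
  obtains t :: "'j \<Rightarrow> real" where "\<forall>j\<in>J. t j \<ge> 0" "sum t J = 1"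
    "\<forall>k\<in>K. (\<Sum>j\<in>J. complex_of_real (t j) * v j k) = 0"
proof -
  define B where "B = {t::'j \<Rightarrow> real. \<forall>j. t j \<in> (if j \<in> J then {0..1} else {0})}"
  define S where "S = B \<inter> {t. sum t J = 1}"
  define w where "w t k = (\<Sum>j\<in>J. complex_of_real (t j) * v j k)" for t k
  define f where "f t = (\<Sum>k\<in>K. (cmod (w t k))\<^sup>2)" for t
  have coord: "continuous_on A (\<lambda>t::'j \<Rightarrow> real. t i)" for A i
    by (rule continuous_on_subset[OF continuous_on_product_coordinates]) simp
  have "compact B" unfolding B_def by (rule compact_box) simp
  moreover have "closed {t::'j \<Rightarrow> real. sum t J = 1}"
    by (intro closed_Collect_eq continuous_on_sum continuous_on_const coord)
  ultimately have "compact S" unfolding S_def by (rule compact_Int_closed)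
  obtain j0 where "j0 \<in> J" using J by blast
  then have "(\<lambda>j. if j = j0 then 1 else 0) \<in> S" using J by (auto simp: S_def B_def)
  then have "S \<noteq> {}" by (metis empty_iff)
  have contf: "continuous_on S f"
    unfolding f_def w_def
    by (intro continuous_intros coord)
  obtain t where t: "t \<in> S" "\<And>s. s \<in> S \<Longrightarrow> f t \<le> f s"
    using continuous_attains_inf[OF \<open>compact S\<close> \<open>S \<noteq> {}\<close> contf] by (elim bexE) (rule that, auto)
  have tB: "t i \<in> (if i \<in> J then {0..1} else {0})" for i
    using t(1) unfolding S_def B_def by blast
  have tJ: "0 \<le> t i" "t i \<le> 1" if "i \<in> J" for i using tB[of i] that by simp_all
  have tn: "t i = 0" if "i \<notin> J" for i using tB[of i] that by simp
  have "\<not> (\<exists>k\<in>K. w t k \<noteq> 0)"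
  proof
    assume "\<exists>k\<in>K. w t k \<noteq> 0"
    then have "\<exists>k\<in>K. - cnj (w t k) \<noteq> 0" by simp
    from alt[OF this] obtain j where j: "j \<in> J" "Re (\<Sum>k\<in>K. - cnj (w t k) * v j k) > 0"
      by blast
    define q where "q = (\<Sum>k\<in>K. Re (cnj (w t k) * (v j k - w t k)))"
    define m where "m = (\<Sum>k\<in>K. (cmod (v j k - w t k))\<^sup>2)"
    have m0: "m \<ge> 0" by (simp add: m_def sum_nonneg)
    have "q = - Re (\<Sum>k\<in>K. - cnj (w t k) * v j k) - f t"
      unfolding q_def f_def cmod_power2 Re_sum sum_negf[symmetric] sum_subtractf[symmetric]
      by (intro sum.cong refl) (simp add: power2_eq_square algebra_simps)
    moreover have "f t \<ge> 0" by (simp add: f_def sum_nonneg)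
    ultimately have q: "q < 0" using j by linarith
    define s where "s = min 1 (- q / (m + 1))"
    have s: "0 < s" "s \<le> 1" "s * (m + 1) \<le> - q"
    proof -
      show "0 < s" "s \<le> 1" using q m0 by (auto simp: s_def divide_neg_pos)
      have "s \<le> - q / (m + 1)" by (simp add: s_def)
      then show "s * (m + 1) \<le> - q"
        by (subst (asm) pos_le_divide_eq) (use m0 in auto)
    qed
    define t' where "t' i = (1 - s) * t i + (if i = j then s else 0)" for i
    have "t' \<in> S"
    proof -
      have "t' i \<in> (if i \<in> J then {0..1} else {0})" for i
      proof (cases "i \<in> J")
        case True
        have "(1 - s) * t i \<le> (1 - s) * 1" using s tJ[OF True] by (intro mult_left_mono) auto
        moreover have "0 \<le> (1 - s) * t i" using s tJ[OF True] by simp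
        ultimately show ?thesis using True s by (auto simp: t'_def)
      next
        case False
        then show ?thesis using tn j(1) by (auto simp: t'_def)
      qed
      moreover have "sum t' J = 1"
        using t(1) J j by (simp add: t'_def S_def sum.distrib flip: sum_distrib_left)
      ultimately show ?thesis by (simp add: S_def B_def)
    qed
    have w': "w t' k = w t k + complex_of_real s * (v j k - w t k)" for k
    proof -
      have "w t' k = (\<Sum>i\<in>J. (1 - complex_of_real s) * (complex_of_real (t i) * v i k)
          + (if i = j then complex_of_real s * v i k else 0))"
        unfolding w_def by (intro sum.cong refl) (auto simp: t'_def algebra_simps)
      also have "\<dots> = (1 - complex_of_real s) * w t k + complex_of_real s * v j k"
        using J j by (simp add: w_def sum.distrib flip: sum_distrib_left)
      finally show ?thesis by (simp add: algebra_simps)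
    qed
    have "f t' = f t + 2 * s * q + s\<^sup>2 * m"
    proof -
      have "(cmod (a + complex_of_real s * b))\<^sup>2 = (cmod a)\<^sup>2 + 2 * s * Re (cnj a * b) + s\<^sup>2 * (cmod b)\<^sup>2" for a b
        unfolding cmod_power2 by (simp add: power2_eq_square algebra_simps)
      then show ?thesis
        by (simp add: f_def w' q_def m_def sum.distrib flip: sum_distrib_left)
    qed
    also have "\<dots> < f t"
    proof -
      have "s * m < - q" using s by (simp add: algebra_simps)
      then have "s * (2 * q + s * m) < 0" using s q by (intro mult_pos_neg) auto
      then show ?thesis by (simp add: power2_eq_square algebra_simps)
    qed
    finally show False using t(2)[OF \<open>t' \<in> S\<close>] by simp
  qed
  then show thesis
    using t(1) tJ(1) by (intro that[of t]) (auto simp: S_def w_def)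
qed

text \<open>Compactness of the unit sphere of coefficients, for which the sum norm is chosen because it
  makes the later perturbation estimate a term by term one.\<close>

lemma finitely_many_points_exceed:
  fixes E :: "complex set" and g :: "complex \<Rightarrow> nat \<Rightarrow> complex"
  assumes K: "finite K"
    and ex: "\<And>a. \<exists>k\<in>K. a k \<noteq> 0 \<Longrightarrow> \<exists>\<mu>\<in>E. Re (\<Sum>k\<in>K. a k * g \<mu> k) > 0"
  obtains M \<delta> where "finite M" "M \<subseteq> E" "\<delta> > 0"
    "\<forall>a. (\<Sum>k\<in>K. cmod (a k)) = 1 \<longrightarrow> (\<exists>\<mu>\<in>M. Re (\<Sum>k\<in>K. a k * g \<mu> k) > \<delta>)"
proof -
  define B where "B = {a::nat \<Rightarrow> complex. \<forall>k. a k \<in> (if k \<in> K then cball 0 1 else {0})}"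
  define S where "S = B \<inter> {a. (\<Sum>k\<in>K. cmod (a k)) = 1}"
  have coord: "continuous_on A (\<lambda>a::nat \<Rightarrow> complex. a i)" for A i
    by (rule continuous_on_subset[OF continuous_on_product_coordinates]) simp
  have "compact B" unfolding B_def by (rule compact_box) simp
  moreover have "closed {a::nat \<Rightarrow> complex. (\<Sum>k\<in>K. cmod (a k)) = 1}"
    by (intro closed_Collect_eq continuous_on_sum continuous_on_const continuous_on_norm coord)
  ultimately have "compact S" unfolding S_def by (rule compact_Int_closed)
  define U where "U = (\<lambda>(\<mu>, m). {a. Re (\<Sum>k\<in>K. a k * g \<mu> k) > 1 / Suc m})"
  have "open (U c)" for c
    unfolding U_def split_beta by (intro open_Collect_less continuous_intros coord)
  moreover have "S \<subseteq> (\<Union>c\<in>E \<times> UNIV. U c)"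
  proof
    fix a assume a: "a \<in> S"
    have "\<exists>k\<in>K. a k \<noteq> 0"
    proof (rule ccontr)
      assume "\<not> ?thesis"
      then have "(\<Sum>k\<in>K. cmod (a k)) = 0" by simp
      then show False using a by (simp add: S_def)
    qed
    from ex[OF this] obtain \<mu> where mu: "\<mu> \<in> E" "Re (\<Sum>k\<in>K. a k * g \<mu> k) > 0" by blast
    then obtain m where "1 / Suc m < Re (\<Sum>k\<in>K. a k * g \<mu> k)"
      using nat_approx_posE by blast
    then show "a \<in> (\<Union>c\<in>E \<times> UNIV. U c)"
      using mu(1) by (intro UN_I[of "(\<mu>, m)"]) (auto simp: U_def)
  qed
  ultimately obtain C where C: "C \<subseteq> E \<times> UNIV" "finite C" "S \<subseteq> (\<Union>c\<in>C. U c)"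
    by (rule compactE_image[OF \<open>compact S\<close>])
  define \<delta> where "\<delta> = Min (insert 1 ((\<lambda>c. 1 / real (Suc (snd c))) ` C))"
  show thesis
  proof (rule that[of "fst ` C" \<delta>])
    show "finite (fst ` C)" "fst ` C \<subseteq> E" using C by auto
    show "\<delta> > 0" using C(2) by (simp add: \<delta>_def)
    show "\<forall>a. (\<Sum>k\<in>K. cmod (a k)) = 1 \<longrightarrow> (\<exists>\<mu>\<in>fst ` C. Re (\<Sum>k\<in>K. a k * g \<mu> k) > \<delta>)"
    proof (intro allI impI)
      fix a :: "nat \<Rightarrow> complex" assume a: "(\<Sum>k\<in>K. cmod (a k)) = 1"
      define b where "b k = (if k \<in> K then a k else 0)" for k
      have eq: "(\<Sum>k\<in>K. b k * h k) = (\<Sum>k\<in>K. a k * h k)" for h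
        by (intro sum.cong) (auto simp: b_def)
      have "cmod (a k) \<le> 1" if "k \<in> K" for k
        using member_le_sum[of k K "\<lambda>k. cmod (a k)"] that K a by simp
      moreover have "(\<Sum>k\<in>K. cmod (b k)) = 1"
        unfolding a[symmetric] by (intro sum.cong) (auto simp: b_def)
      ultimately have "b \<in> S" by (auto simp: S_def B_def b_def)
      then obtain c where c: "c \<in> C" "b \<in> U c" using C(3) by blast
      have "\<delta> \<le> 1 / real (Suc (snd c))"
        unfolding \<delta>_def using C(2) c(1) by (intro Min_le) auto
      also have "\<dots> < Re (\<Sum>k\<in>K. a k * g (fst c) k)"
        using c(2) unfolding U_def split_beta mem_Collect_eq eq .
      finally show "\<exists>\<mu>\<in>fst ` C. Re (\<Sum>k\<in>K. a k * g \<mu> k) > \<delta>"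
        using c(1) by blast
    qed
  qed
qed

text \<open>For every nonconstant polynomial \<open>p\<close> some point \<open>\<mu>\<close> of the approximate essential spectrum has
  \<open>Re (p \<mu>) > Re (p \<zeta>)\<close>, and finitely many points \<open>\<mu>\<close> and a common margin serve all \<open>p\<close> of degree at
  most \<open>n\<close>. Approximate eigenvectors at these points, chosen with mutually orthogonal orbits, have
  moments close to \<open>\<mu> ^ k\<close>. Because of the margin their moment vectors still surround
  \<open>(\<zeta>, \<dots>, \<zeta> ^ n)\<close>, which is thus a convex combination of them, with weights \<open>t j\<close>; the combination
  of the vectors with coefficients \<open>sqrt (t j)\<close> attains it exactly.\<close>

lemma vector_with_prescribed_moments:
  fixes T :: "'a::complex_hilbert_space \<Rightarrow> 'a"
  assumes T: "bounded_operator T"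
    and hull: "ball 0 1 \<subseteq> polynomial_hull (op_spectrum T)"
    and zeta: "\<zeta> \<in> ball 0 1" and F: "finite F"
  obtains x where "orthogonal_to x F" "\<And>k. k \<le> n \<Longrightarrow> cinner ((T ^^ k) x) x = \<zeta> ^ k"
proof -
  let ?E = "approx_ess_spectrum T"
  let ?K = "{1..n}"
  have exceed: "\<exists>\<mu>\<in>?E. Re (\<Sum>k\<in>?K. a k * (\<mu> ^ k - \<zeta> ^ k)) > 0" if a: "\<exists>k\<in>?K. a k \<noteq> 0" for a
  proof -
    define b where "b k = (if k = 0 then 0 else a k)" for k
    define p where "p z = (\<Sum>k\<le>n. b k * z ^ k)" for z :: complex
    have p: "p z = (\<Sum>k\<in>?K. a k * z ^ k)" for z
    proof -
      have "{..n} = insert 0 ?K" by auto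
      then show ?thesis by (auto simp: p_def b_def intro!: sum.cong)
    qed
    have "\<not> p constant_on UNIV"
    proof
      assume "p constant_on UNIV"
      then obtain c where c: "\<And>z. p z = c" by (auto simp: constant_on_def)
      have "\<forall>z. (\<Sum>k\<le>n. b k * z ^ k) = c"
        by (intro allI) (rule c[unfolded p_def])
      from this[unfolded polyfun_eq_const] show False using a by (auto simp: b_def)
    qed
    moreover have "p holomorphic_on UNIV" unfolding p_def by (intro holomorphic_intros)
    ultimately obtain \<mu> where "\<mu> \<in> ?E" "Re (p \<mu>) > Re (p \<zeta>)"
      using approx_ess_spectrum_exceeds[OF T hull _ _ zeta] by blast
    moreover have "(\<Sum>k\<in>?K. a k * (\<mu> ^ k - \<zeta> ^ k)) = p \<mu> - p \<zeta>"
      by (simp add: p right_diff_distrib sum_subtractf)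
    ultimately show ?thesis by (intro bexI[of _ \<mu>]) simp_all
  qed
  obtain M0 \<delta> where M0: "finite M0" "M0 \<subseteq> ?E" "\<delta> > 0"
    and M: "\<forall>a. (\<Sum>k\<in>?K. cmod (a k)) = 1 \<longrightarrow>
        (\<exists>\<mu>\<in>M0. Re (\<Sum>k\<in>?K. a k * (\<mu> ^ k - \<zeta> ^ k)) > \<delta>)"
    by (rule finitely_many_points_exceed[of ?K ?E "\<lambda>\<mu> k. \<mu> ^ k - \<zeta> ^ k", OF finite_atLeastAtMost exceed])
  have nonconst: "\<not> (\<lambda>z::complex. z) constant_on UNIV"
    unfolding constant_on_def by (metis UNIV_I zero_neq_one)
  obtain \<mu>0 where mu0: "\<mu>0 \<in> ?E"
    using approx_ess_spectrum_exceeds[OF T hull holomorphic_on_ident nonconst zeta] by blast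
  \<comment> \<open>The point \<open>\<mu>0\<close> keeps the index set nonempty when \<open>n = 0\<close>.\<close>
  let ?M = "insert \<mu>0 M0"
  define m where "m = from_nat_into ?M"
  have rm: "range m = ?M"
    unfolding m_def by (rule range_from_nat_into) (use M0 in \<open>auto intro: countable_finite\<close>)
  have "finite ?M" "?M \<subseteq> m ` UNIV" using M0(1) rm by simp_all
  from finite_subset_image[OF this] obtain J where J: "finite J" "m ` J = ?M" by blast
  have mE: "m j \<in> ?E" for j
  proof -
    have "m j \<in> ?M" unfolding rm[symmetric] by (rule rangeI)
    then show ?thesis using M0(2) mu0 by blast
  qed
  let ?P = "\<lambda>j x. norm x = 1 \<and> orthogonal_to x F \<and> (\<forall>k\<le>n. cmod (cinner ((T ^^ k) x) x - m j ^ k) < \<delta>)"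
  have "\<exists>x. orthogonal_to x G \<and> ?P j x" if G: "finite G" for j G
  proof -
    obtain K where K: "K > 0"
      "\<And>k x. k \<le> n \<Longrightarrow> norm x = 1 \<Longrightarrow> cmod (cinner ((T ^^ k) x) x - m j ^ k) \<le> K * norm (T x - m j *\<^sub>C x)"
      using approx_eigenvector_power[OF T] by blast
    have "finite (F \<union> G)" "\<delta> / K > 0" using F G K(1) M0(3) by simp_all
    then obtain x where x: "norm x = 1" "orthogonal_to x (F \<union> G)" "norm (T x - m j *\<^sub>C x) < \<delta> / K"
      using mE[of j] unfolding approx_ess_spectrum_def by blast
    have "K * norm (T x - m j *\<^sub>C x) < \<delta>"
      using x(3) K(1) by (simp add: field_simps)
    then have "cmod (cinner ((T ^^ k) x) x - m j ^ k) < \<delta>" if "k \<le> n" for k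
      using K(2)[OF that x(1)] by linarith
    then show ?thesis using x by (auto simp: orthogonal_to_Un)
  qed
  then obtain x where x: "\<forall>j. ?P j (x j)"
    and orth: "\<forall>i j k. i \<noteq> j \<longrightarrow> k \<le> n \<longrightarrow> cinner ((T ^^ k) (x i)) (x j) = 0"
    by (rule orthogonal_orbit_sequence[OF T, of ?P n])
  define v where "v j k = cinner ((T ^^ k) (x j)) (x j) - \<zeta> ^ k" for j k
  have sep: "\<exists>j\<in>J. Re (\<Sum>k\<in>?K. a k * v j k) > 0" if a: "\<exists>k\<in>?K. a k \<noteq> 0" for a
  proof -
    define N where "N = (\<Sum>k\<in>?K. cmod (a k))"
    have N: "N > 0" using a unfolding N_def by (metis finite_atLeastAtMost norm_ge_zero sum_pos2 zero_less_norm_iff)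
    define b where "b k = a k / complex_of_real N" for k
    have b: "(\<Sum>k\<in>?K. cmod (b k)) = 1"
    proof -
      have "cmod (b k) = cmod (a k) / N" for k using N by (simp add: b_def norm_divide)
      then have "(\<Sum>k\<in>?K. cmod (b k)) = N / N"
        by (simp only: sum_divide_distrib[symmetric] N_def[symmetric])
      then show ?thesis using N by simp
    qed
    obtain j where j: "j \<in> J" "Re (\<Sum>k\<in>?K. b k * (m j ^ k - \<zeta> ^ k)) > \<delta>"
    proof -
      obtain \<mu> where mu: "\<mu> \<in> M0" "Re (\<Sum>k\<in>?K. b k * (\<mu> ^ k - \<zeta> ^ k)) > \<delta>"
        using M b by blast
      then have "\<mu> \<in> m ` J" using J(2) by simp
      then show ?thesis using mu(2) that by blast
    qed
    have "cmod (\<Sum>k\<in>?K. b k * (cinner ((T ^^ k) (x j)) (x j) - m j ^ k))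
        \<le> (\<Sum>k\<in>?K. cmod (b k) * \<delta>)"
    proof (rule sum_norm_le)
      fix k assume "k \<in> ?K"
      then have "cmod (cinner ((T ^^ k) (x j)) (x j) - m j ^ k) \<le> \<delta>"
        using x by (simp add: less_imp_le)
      then show "cmod (b k * (cinner ((T ^^ k) (x j)) (x j) - m j ^ k)) \<le> cmod (b k) * \<delta>"
        unfolding norm_mult by (rule mult_left_mono) simp
    qed
    also have "\<dots> = \<delta>" using b by (simp flip: sum_distrib_right)
    finally have "\<bar>Re (\<Sum>k\<in>?K. b k * (cinner ((T ^^ k) (x j)) (x j) - m j ^ k))\<bar> \<le> \<delta>"
      using abs_Re_le_cmod order_trans by blast
    moreover have "(\<Sum>k\<in>?K. b k * v j k) = (\<Sum>k\<in>?K. b k * (cinner ((T ^^ k) (x j)) (x j) - m j ^ k))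
        + (\<Sum>k\<in>?K. b k * (m j ^ k - \<zeta> ^ k))"
      unfolding v_def sum.distrib[symmetric] by (intro sum.cong refl) (simp add: algebra_simps)
    ultimately have "Re (\<Sum>k\<in>?K. b k * v j k) > 0" using j(2) by (simp only: plus_complex.sel)
    moreover have "(\<Sum>k\<in>?K. b k * v j k) = (\<Sum>k\<in>?K. a k * v j k) / complex_of_real N"
      by (simp add: b_def sum_divide_distrib)
    ultimately have "Re (\<Sum>k\<in>?K. a k * v j k) / N > 0"
      by (simp only: Re_divide_of_real)
    then show ?thesis using j(1) N by (intro bexI[of _ j]) (simp_all only: zero_less_divide_iff, auto)
  qed
  have "J \<noteq> {}" using J(2) by blast
  then obtain t where t: "\<forall>j\<in>J. t j \<ge> 0" "sum t J = 1"
    "\<forall>k\<in>?K. (\<Sum>j\<in>J. complex_of_real (t j) * v j k) = 0"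
    by (rule zero_in_convex_hull[OF J(1) _ finite_atLeastAtMost sep])
  define y where "y = (\<Sum>j\<in>J. complex_of_real (sqrt (t j)) *\<^sub>C x j)"
  have "cinner ((T ^^ k) y) y = \<zeta> ^ k" if k: "k \<le> n" for k
  proof -
    have "cinner ((T ^^ k) y) y = (\<Sum>j\<in>J. complex_of_real (sqrt (t j)) * cnj (complex_of_real (sqrt (t j)))
        * cinner ((T ^^ k) (x j)) (x j))"
      unfolding y_def using orth k
      by (intro cinner_sum_orthogonal bounded_operator_funpow T J) auto
    also have "\<dots> = (\<Sum>j\<in>J. complex_of_real (t j) * (v j k + \<zeta> ^ k))"
      using t(1) by (intro sum.cong refl) (simp add: v_def flip: of_real_mult)
    also have "\<dots> = (\<Sum>j\<in>J. complex_of_real (t j) * v j k) + complex_of_real (sum t J) * \<zeta> ^ k"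
      by (simp add: distrib_left sum.distrib sum_distrib_right)
    also have "(\<Sum>j\<in>J. complex_of_real (t j) * v j k) = 0"
    proof (cases "k = 0")
      case True
      then show ?thesis using x by (simp add: v_def cinner_self)
    next
      case False
      then show ?thesis using k by (intro t(3)[rule_format]) auto
    qed
    finally show ?thesis by (simp add: t(2))
  qed
  moreover have "orthogonal_to y F"
    using x by (simp add: y_def orthogonal_to_def cinner.sum_left cinner_scaleC_left)
  ultimately show thesis by (rule that[rotated])
qed

section \<open>Positive forms on separable spaces\<close>

definition sesquilinear :: "('a::complex_hilbert_space \<Rightarrow> 'a \<Rightarrow> complex) \<Rightarrow> bool" where
  "sesquilinear q \<longleftrightarrow>
     (\<forall>x y z. q (x + y) z = q x z + q y z) \<and> (\<forall>a x y. q (a *\<^sub>C x) y = a * q x y) \<and>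
     (\<forall>x y. q x y = cnj (q y x))"

definition positive_form :: "('a::complex_hilbert_space \<Rightarrow> 'a \<Rightarrow> complex) \<Rightarrow> bool" where
  "positive_form q \<longleftrightarrow> sesquilinear q \<and> (\<forall>x. Re (q x x) \<ge> 0)"

lemma sesquilinearD:
  assumes "sesquilinear q"
  shows "q (x + y) z = q x z + q y z" "q (a *\<^sub>C x) y = a * q x y" "q x y = cnj (q y x)"
    "q z (x + y) = q z x + q z y" "q y (a *\<^sub>C x) = cnj a * q y x" "Im (q x x) = 0"
proof -
  show *: "q (x + y) z = q x z + q y z" "q (a *\<^sub>C x) y = a * q x y" "q x y = cnj (q y x)" for x y z a
    using assms unfolding sesquilinear_def by blast+
  show "q z (x + y) = q z x + q z y"
    using *(3)[of z "x + y"] *(3)[of z x] *(3)[of z y] by (simp add: *(1))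
  show "q y (a *\<^sub>C x) = cnj a * q y x"
    using *(3)[of y "a *\<^sub>C x"] *(3)[of y x] by (simp add: *(2))
  show "Im (q x x) = 0"
    using *(3)[of x x] by (metis cnj.simps(2) equal_neg_zero)
qed

lemma sesquilinear_Re_add_scale:
  assumes "sesquilinear q"
  shows "Re (q (x + a *\<^sub>C y) (x + a *\<^sub>C y))
    = Re (q x x) + 2 * Re (a * q y x) + (cmod a)\<^sup>2 * Re (q y y)"
proof -
  note s = sesquilinearD[OF assms]
  have "q (x + a *\<^sub>C y) (x + a *\<^sub>C y) = q x x + (a * q y x + cnj (a * q y x)) + (a * cnj a) * q y y"
    by (simp add: s(1,2,4,5) s(3)[of x y] algebra_simps)
  also have "Re \<dots> = Re (q x x) + 2 * Re (a * q y x) + (cmod a)\<^sup>2 * Re (q y y)"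
    by (simp only: complex_add_cnj complex_norm_square[symmetric]) (simp add: Re_power2)
  finally show ?thesis .
qed

lemma positive_form_cauchy_schwarz:
  assumes "positive_form q"
  shows "(cmod (q x y))\<^sup>2 \<le> Re (q x x) * Re (q y y)"
proof -
  have s: "sesquilinear q" and pos: "\<And>x. Re (q x x) \<ge> 0"
    using assms by (auto simp: positive_form_def)
  have qyx: "q y x = cnj (q x y)" by (rule sesquilinearD(3)[OF s])
  \<comment> \<open>The direction of \<open>a\<close> is the one in which the form decreases fastest.\<close>
  have key: "0 \<le> Re (q x x) - 2 * t * (cmod (q x y))\<^sup>2 + t\<^sup>2 * (cmod (q x y))\<^sup>2 * Re (q y y)" for t :: real
  proof -
    have "Re ((- complex_of_real t * q x y) * q y x) = - t * (cmod (q x y))\<^sup>2"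
      unfolding qyx mult.assoc complex_norm_square[symmetric]
      by (simp flip: of_real_power of_real_mult of_real_minus)
    then show ?thesis
      using pos[of "x + (- complex_of_real t * q x y) *\<^sub>C y"]
      by (simp only: sesquilinear_Re_add_scale[OF s]) (simp add: norm_mult power_mult_distrib)
  qed
  show ?thesis
  proof (cases "Re (q y y) = 0")
    case True
    have "(cmod (q x y))\<^sup>2 = 0"
    proof (rule ccontr)
      assume n: "(cmod (q x y))\<^sup>2 \<noteq> 0"
      have "0 \<le> Re (q x x) - 2 * ((Re (q x x) + 1) / (cmod (q x y))\<^sup>2) * (cmod (q x y))\<^sup>2"
        using key[of "(Re (q x x) + 1) / (cmod (q x y))\<^sup>2"] True by simp
      also have "\<dots> = Re (q x x) - 2 * (Re (q x x) + 1)" using n by simp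
      finally show False using pos[of x] by simp
    qed
    then show ?thesis using True by simp
  next
    case False
    then have p: "Re (q y y) > 0" using pos[of y] by simp
    have "0 \<le> Re (q x x) - (cmod (q x y))\<^sup>2 / Re (q y y)"
      using key[of "1 / Re (q y y)"] p by (simp add: power2_eq_square)
    then show ?thesis using p by (simp add: field_simps)
  qed
qed

text \<open>One step of symmetric Gaussian elimination: the form \<open>q\<close> minus the square of the functional
  \<open>q(\<cdot>, d) / sqrt (q(d, d))\<close>, a form that is still positive and vanishes at \<open>d\<close>. If \<open>q(d, d) = 0\<close>,
  the convention \<open>x / 0 = 0\<close> leaves \<open>q\<close> as it is.\<close>

definition pivot :: "('a::complex_hilbert_space \<Rightarrow> 'a \<Rightarrow> complex) \<Rightarrow> 'a \<Rightarrow> 'a \<Rightarrow> complex" where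
  "pivot q d x = q x d / complex_of_real (sqrt (Re (q d d)))"

definition eliminate ::
  "('a::complex_hilbert_space \<Rightarrow> 'a \<Rightarrow> complex) \<Rightarrow> 'a \<Rightarrow> 'a \<Rightarrow> 'a \<Rightarrow> complex" where
  "eliminate q d x y = q x y - pivot q d x * cnj (pivot q d y)"

lemma eliminate:
  assumes q: "positive_form q"
  shows "positive_form (eliminate q d)" "Re (eliminate q d d d) = 0"
    "Re (eliminate q d x x) \<le> Re (q x x)"
proof -
  have s: "sesquilinear q" and pos: "\<And>x. Re (q x x) \<ge> 0"
    using q by (auto simp: positive_form_def)
  note S = sesquilinearD[OF s]
  have diag: "Re (eliminate q d x x) = Re (q x x) - (cmod (pivot q d x))\<^sup>2" for x
    unfolding eliminate_def by (simp flip: complex_norm_square)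
  have piv: "(cmod (pivot q d x))\<^sup>2 = (cmod (q x d))\<^sup>2 / Re (q d d)" for x
    using pos[of d] by (simp add: pivot_def norm_divide power_divide)
  have le: "(cmod (pivot q d x))\<^sup>2 \<le> Re (q x x)" for x
    unfolding piv using positive_form_cauchy_schwarz[OF q, of x d] pos[of d] pos[of x]
    by (cases "Re (q d d) = 0") (auto simp: field_simps)
  have "sesquilinear (eliminate q d)"
    unfolding sesquilinear_def
  proof (intro conjI allI)
    show "eliminate q d (x + y) z = eliminate q d x z + eliminate q d y z" for x y z
      by (simp add: eliminate_def pivot_def S(1) add_divide_distrib algebra_simps)
    show "eliminate q d (a *\<^sub>C x) y = a * eliminate q d x y" for a x y
      by (simp add: eliminate_def pivot_def S(2) algebra_simps)
    show "eliminate q d x y = cnj (eliminate q d y x)" for x y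
      using S(3)[of x y] by (simp add: eliminate_def mult.commute)
  qed
  with le show "positive_form (eliminate q d)" by (simp add: positive_form_def diag)
  show "Re (eliminate q d x x) \<le> Re (q x x)" by (simp add: diag)
  have "(cmod (q d d))\<^sup>2 = (Re (q d d))\<^sup>2" using S(6)[of d] by (simp add: cmod_power2)
  then show "Re (eliminate q d d d) = 0"
    by (simp only: diag piv) (simp add: power2_eq_square)
qed

primrec eliminated ::
  "('a::complex_hilbert_space \<Rightarrow> 'a \<Rightarrow> complex) \<Rightarrow> (nat \<Rightarrow> 'a) \<Rightarrow> nat \<Rightarrow> 'a \<Rightarrow> 'a \<Rightarrow> complex" where
  "eliminated q d 0 = q"
| "eliminated q d (Suc m) = eliminate (eliminated q d m) (d m)"

text \<open>Cholesky decomposition along a dense sequence. The forms left over after elimination decrease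
  and vanish at the vectors already treated, hence, the form being bounded, tend to 0 everywhere. No
  orthonormal basis and no square root of an operator is involved.\<close>

lemma positive_form_decomposition:
  fixes q :: "'a::complex_hilbert_space \<Rightarrow> 'a \<Rightarrow> complex" and d :: "nat \<Rightarrow> 'a"
  assumes q: "positive_form q" and bound: "\<And>x. Re (q x x) \<le> B * (norm x)\<^sup>2"
    and dense: "\<And>x e. e > 0 \<Longrightarrow> \<exists>i. norm (x - d i) < e"
  obtains \<phi> :: "nat \<Rightarrow> 'a \<Rightarrow> complex"
  where "\<forall>i x y. \<phi> i (x + y) = \<phi> i x + \<phi> i y" "\<forall>i a x. \<phi> i (a *\<^sub>C x) = a * \<phi> i x"
    "\<forall>x y. (\<lambda>i. \<phi> i x * cnj (\<phi> i y)) sums q x y"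
proof -
  let ?q = "eliminated q d"
  have pf: "positive_form (?q m)" for m
    by (induction m) (auto simp: q eliminate(1))
  have ss: "sesquilinear (?q m)" and pos: "Re (?q m x x) \<ge> 0" for m x
    using pf[of m] by (auto simp: positive_form_def)
  have antimono: "Re (?q n x x) \<le> Re (?q m x x)" if "m \<le> n" for m n x
    using that
  proof (induction rule: dec_induct)
    case (step k)
    then show ?case using eliminate(3)[OF pf[of k], of "d k" x] by simp
  qed simp
  have van: "Re (?q m (d i) (d i)) = 0" if "i < m" for i m
    using antimono[of "Suc i" m "d i"] that eliminate(2)[OF pf[of i], of "d i"] pos[of m "d i"] by simp
  have small: "(\<lambda>m. Re (?q m x x)) \<longlonglongrightarrow> 0" for x
  proof (rule LIMSEQ_I)
    fix e :: real assume e: "e > 0"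
    define r where "r = sqrt (e / (\<bar>B\<bar> + 1))"
    have r: "r > 0" "(\<bar>B\<bar> + 1) * r\<^sup>2 = e" using e by (auto simp: r_def)
    obtain i where i: "norm (x - d i) < r" using dense[OF r(1)] by blast
    have "norm (Re (?q m x x) - 0) < e" if m: "m \<ge> Suc i" for m
    proof -
      let ?y = "x - d i"
      have "(cmod (?q m (d i) ?y))\<^sup>2 \<le> 0"
        using positive_form_cauchy_schwarz[OF pf[of m], of "d i" ?y] van[of i m] m by simp
      then have z: "?q m (d i) ?y = 0" by simp
      have "Re (?q m x x) = Re (?q m (?y + 1 *\<^sub>C d i) (?y + 1 *\<^sub>C d i))" by simp
      also have "\<dots> = Re (?q m ?y ?y)"
        unfolding sesquilinear_Re_add_scale[OF ss] z using van[of i m] m by simp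
      also have "\<dots> \<le> Re (q ?y ?y)" using antimono[of 0 m ?y] by simp
      also have "\<dots> \<le> B * (norm ?y)\<^sup>2" by (rule bound)
      also have "\<dots> \<le> (\<bar>B\<bar> + 1) * (norm ?y)\<^sup>2" by (intro mult_right_mono) auto
      also have "\<dots> < (\<bar>B\<bar> + 1) * r\<^sup>2"
        using i by (intro mult_strict_left_mono power_strict_mono) auto
      finally show ?thesis using pos[of m x] r(2) by simp
    qed
    then show "\<exists>no. \<forall>m\<ge>no. norm (Re (?q m x x) - 0) < e" by blast
  qed
  define \<phi> where "\<phi> i = pivot (?q i) (d i)" for i
  have part: "(\<Sum>i<m. \<phi> i x * cnj (\<phi> i y)) = q x y - ?q m x y" for m x y
    by (induction m) (auto simp: \<phi>_def eliminate_def)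
  have "(\<lambda>i. \<phi> i x * cnj (\<phi> i y)) sums q x y" for x y
  proof -
    have "(\<lambda>m. ?q m x y) \<longlonglongrightarrow> 0"
    proof (rule Lim_null_comparison)
      have "cmod (?q m x y) \<le> sqrt (Re (?q m x x) * Re (?q m y y))" for m
        using positive_form_cauchy_schwarz[OF pf[of m], of x y] by (rule real_le_rsqrt)
      then show "\<forall>\<^sub>F m in sequentially. cmod (?q m x y) \<le> sqrt (Re (?q m x x) * Re (?q m y y))"
        by simp
      show "(\<lambda>m. sqrt (Re (?q m x x) * Re (?q m y y))) \<longlonglongrightarrow> 0"
        using tendsto_real_sqrt[OF tendsto_mult[OF small[of x] small[of y]]] by simp
    qed
    then have "(\<lambda>m. q x y - ?q m x y) \<longlonglongrightarrow> q x y - 0" by (intro tendsto_intros)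
    then show ?thesis by (simp add: sums_def part)
  qed
  moreover have "\<phi> i (x + y) = \<phi> i x + \<phi> i y" "\<phi> i (a *\<^sub>C x) = a * \<phi> i x" for i x y a
    by (simp_all add: \<phi>_def pivot_def sesquilinearD(1,2)[OF ss] add_divide_distrib)
  ultimately show thesis by (intro that[of \<phi>]) auto
qed

section \<open>Strict contractions as quadrature sums\<close>

text \<open>The right hand side is the quadratic form of a truncated operator Poisson kernel at \<open>x\<close>. With \<open>y\<close>
  the partial sum of the Neumann series and \<open>e\<close> its remainder, \<open>x = y - D y + e\<close>, and the form equals
  \<open>\<parallel>y\<parallel>\<^sup>2 - \<parallel>D y\<parallel>\<^sup>2\<close> up to terms in \<open>e\<close>.\<close>

lemma truncated_poisson_kernel_positive:
  fixes D :: "'a::complex_hilbert_space \<Rightarrow> 'a"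
  assumes D: "bounded_operator D" and r: "0 \<le> r" "r < 1" "\<And>x. norm (D x) \<le> r * norm x"
    and M: "r ^ (M + 1) \<le> (1 - r\<^sup>2) / 16"
  shows "0 \<le> (norm x)\<^sup>2 + 2 * (\<Sum>m=1..M. inner ((D ^^ m) x) x)"
proof -
  note lin = bounded_operatorD[OF D]
  define y where "y = (\<Sum>m\<le>M. (D ^^ m) x)"
  define e where "e = (D ^^ (M + 1)) x"
  define \<rho> where "\<rho> = r ^ (M + 1)"
  have Dy: "D y = (\<Sum>m\<le>M. (D ^^ Suc m) x)"
    using linear_sum[OF bounded_linear.linear[OF lin(1)]] by (simp add: y_def)
  have "y - D y = (\<Sum>m\<le>M. (D ^^ m) x - (D ^^ Suc m) x)"
    by (simp only: Dy sum_subtractf y_def[symmetric])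
  also have "\<dots> = x - e"
    using sum_telescope[of "\<lambda>m. (D ^^ m) x" M] by (simp add: e_def)
  finally have x: "x = y - D y + e" by (simp add: algebra_simps)
  have "{..M} = insert 0 {1..M}" by auto
  then have y': "y = x + (\<Sum>m=1..M. (D ^^ m) x)" by (simp add: y_def)
  have "(norm x)\<^sup>2 + 2 * (\<Sum>m=1..M. inner ((D ^^ m) x) x) = inner (2 *\<^sub>R y - x) x"
    by (simp add: y' inner_left_distrib inner_diff_left inner_sum_left power2_norm_eq_inner)
  also have "2 *\<^sub>R y - x = y + D y - e" by (subst x) (simp add: scaleR_2)
  also have "inner (y + D y - e) x = inner (y + D y - e) (y - D y + e)"
    by (simp only: x[symmetric])
  also have "\<dots> = (norm y)\<^sup>2 - (norm (D y))\<^sup>2 + 2 * inner (D y) e - (norm e)\<^sup>2"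
    by (simp add: power2_norm_eq_inner inner_left_distrib inner_diff_left inner_right_distrib
        inner_diff_right inner_commute)
  finally have kernel: "(norm x)\<^sup>2 + 2 * (\<Sum>m=1..M. inner ((D ^^ m) x) x)
      = (norm y)\<^sup>2 - (norm (D y))\<^sup>2 + 2 * inner (D y) e - (norm e)\<^sup>2" .
  have "norm ((D ^^ m) x) \<le> r ^ m * norm x" for m
  proof (induction m)
    case (Suc m)
    have "norm ((D ^^ Suc m) x) \<le> r * norm ((D ^^ m) x)" using r(3) by simp
    also have "\<dots> \<le> r * (r ^ m * norm x)" by (intro mult_left_mono Suc r)
    finally show ?case by simp
  qed simp
  then have e: "norm e \<le> \<rho> * norm x" unfolding e_def \<rho>_def .
  have rho: "0 \<le> \<rho>" "\<rho> \<le> (1 - r\<^sup>2) / 16" using r M by (simp_all add: \<rho>_def)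
  then have rho16: "\<rho> \<le> 1/16" by (simp add: order_trans)
  have Dyy: "norm (D y) \<le> r * norm y" by (rule r)
  then have "norm (D y) \<le> norm y" using mult_left_le_one_le[of "norm y" r] r(1,2) by simp
  moreover have "norm x \<le> norm y + norm (D y) + norm e"
    by (subst x) (meson norm_triangle_ineq norm_triangle_ineq4 order_trans add_mono order_refl)
  moreover have "\<rho> * norm x \<le> 1/16 * norm x" using rho16 by (rule mult_right_mono) simp
  ultimately have "norm x \<le> 3 * norm y" using e norm_ge_zero[of y] by linarith
  then have e3: "norm e \<le> 3 * \<rho> * norm y"
    using e mult_left_mono[of "norm x" "3 * norm y" \<rho>] rho(1) by linarith
  have "\<bar>inner (D y) e\<bar> \<le> norm (D y) * norm e" by (rule Cauchy_Schwarz_ineq2)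
  also have "\<dots> \<le> norm y * (3 * \<rho> * norm y)"
    using \<open>norm (D y) \<le> norm y\<close> e3 by (intro mult_mono) auto
  also have "\<dots> = 3 * \<rho> * (norm y)\<^sup>2" by (simp add: power2_eq_square)
  finally have i1: "- (3 * \<rho> * (norm y)\<^sup>2) \<le> inner (D y) e" by linarith
  have "(norm (D y))\<^sup>2 \<le> (r * norm y)\<^sup>2" using Dyy by (rule power_mono) simp
  then have i2: "(norm (D y))\<^sup>2 \<le> r\<^sup>2 * (norm y)\<^sup>2" by (simp add: power_mult_distrib)
  have "(norm e)\<^sup>2 \<le> (3 * \<rho> * norm y)\<^sup>2" using e3 by (rule power_mono) simp
  also have "\<dots> = 9 * \<rho> * \<rho> * (norm y)\<^sup>2" by (simp add: power2_eq_square)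
  also have "\<dots> \<le> 1 * \<rho> * (norm y)\<^sup>2"
    using rho rho16 by (intro mult_right_mono) auto
  finally have i3: "(norm e)\<^sup>2 \<le> \<rho> * (norm y)\<^sup>2" by simp
  \<comment> \<open>The two terms in \<open>e\<close> cost \<open>6 * \<rho>\<close> and \<open>\<rho>\<close>, less than the gap \<open>1 - r\<^sup>2\<close>.\<close>
  have "0 \<le> (1 - r\<^sup>2 - 7 * \<rho>) * (norm y)\<^sup>2"
  proof -
    have "r\<^sup>2 \<le> 1" using r by (simp add: power_le_one)
    then have "0 \<le> 1 - r\<^sup>2 - 7 * \<rho>" using rho by (simp add: field_simps)
    then show ?thesis by simp
  qed
  also have "\<dots> \<le> (norm y)\<^sup>2 - (norm (D y))\<^sup>2 + 2 * inner (D y) e - (norm e)\<^sup>2"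
    using i1 i2 i3 by (simp add: algebra_simps)
  finally show ?thesis by (simp only: kernel)
qed

lemma sum_powers_root_of_unity:
  fixes z :: complex
  assumes "z ^ N = 1"
  shows "(\<Sum>j<N. z ^ j) = (if z = 1 then of_nat N else 0)"
  using assms geometric_sum[of z N] by auto

text \<open>The \<open>j\<close>-th form is, with \<open>lam j = s w\<^sup>j\<close> for a primitive root of unity \<open>w\<close> of order \<open>N = 2 M + 1\<close>,
  the truncated Poisson kernel of \<open>C / lam j\<close> divided by \<open>N\<close>. Any \<open>s\<close> between \<open>c\<close> and 1 keeps the nodes
  in the open disc and the operators \<open>C / lam j\<close> strict contractions. The quadrature formula is the
  orthogonality of the characters of the cyclic group of order \<open>N\<close>. It is exact because the exponents
  \<open>k - m\<close> and \<open>k + m\<close> that occur lie strictly between \<open>- N\<close> and \<open>N\<close> and vanish only in the term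
  that is wanted.\<close>

lemma strict_contraction_quadrature:
  fixes C :: "'a::complex_hilbert_space \<Rightarrow> 'a"
  assumes C: "bounded_operator C" and c: "0 \<le> c" "c < 1" "\<And>x. norm (C x) \<le> c * norm x"
  obtains N :: nat and lam :: "nat \<Rightarrow> complex" and q :: "nat \<Rightarrow> 'a \<Rightarrow> 'a \<Rightarrow> complex" and B :: real
  where "\<forall>j. lam j \<in> ball 0 1" "\<forall>j. positive_form (q j)"
    "\<forall>j x. Re (q j x x) \<le> B * (norm x)\<^sup>2"
    "\<forall>k\<le>n. \<forall>x y. (\<Sum>j<N. lam j ^ k * q j x y) = cinner ((C ^^ k) x) y"
proof -
  define s where "s = (1 + c) / 2"
  have s: "0 < s" "s < 1" "c < s" using c by (auto simp: s_def)
  define r where "r = c / s"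
  have r: "0 \<le> r" "r < 1" using c s by (auto simp: r_def)
  have "r\<^sup>2 < 1" using r by (simp add: power_less_one_iff)
  then have "(1 - r\<^sup>2) / 16 > 0" by simp
  moreover have "(\<lambda>m. r ^ m) \<longlonglongrightarrow> 0" using r by (intro LIMSEQ_realpow_zero) auto
  ultimately obtain M0 where M0: "\<And>m. m \<ge> M0 \<Longrightarrow> r ^ m < (1 - r\<^sup>2) / 16"
    by (metis (no_types, lifting) LIMSEQ_iff diff_zero norm_of_real abs_le_D1 abs_less_iff real_norm_def)
  define M where "M = max M0 n"
  have "M0 \<le> M + 1" by (simp add: M_def)
  from less_imp_le[OF M0[OF this]] have M: "r ^ (M + 1) \<le> (1 - r\<^sup>2) / 16" .
  have nM: "n \<le> M" by (simp add: M_def)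
  define N where "N = 2 * M + 1"
  define W where "W p = exp (2 * complex_of_real pi * \<i> * of_nat p / of_nat N)" for p :: nat
  define w where "w = W 1"
  have Wp: "w ^ p = W p" for p
    unfolding w_def W_def by (simp add: exp_of_nat_mult[symmetric] mult_ac)
  have wN: "w ^ N = 1" unfolding w_def W_def using complex_root_unity[of N 1] by (simp add: N_def)
  have wpN: "(w ^ p) ^ N = 1" for p by (metis wN mult.commute power_mult power_one)
  have weq: "w ^ a = w ^ b \<longleftrightarrow> a mod N = b mod N" for a b
    unfolding Wp unfolding W_def by (rule complex_root_unity_eq) (simp add: N_def)
  have nw: "cmod w = 1" unfolding w_def W_def by simp
  then have w0: "w \<noteq> 0" by auto
  define lam where "lam j = complex_of_real s * w ^ j" for j
  have nlam: "cmod (lam j) = s" for j using s by (simp add: lam_def norm_mult norm_power nw)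
  define q where "q j x y = (cinner x y + (\<Sum>m=1..M. (1 / lam j) ^ m * cinner ((C ^^ m) x) y
      + cnj ((1 / lam j) ^ m) * cinner x ((C ^^ m) y))) / of_nat N" for j x y
  have Cm: "bounded_operator (C ^^ m)" for m by (rule bounded_operator_funpow[OF C])
  have ses: "sesquilinear (q j)" for j
    unfolding sesquilinear_def
  proof (intro conjI allI)
    show "q j (x + y) z = q j x z + q j y z" for x y z
      by (simp add: q_def bounded_operatorD[OF Cm] cinner.add_left sum.distrib algebra_simps
          add_divide_distrib)
    show "q j (a *\<^sub>C x) y = a * q j x y" for a x y
      by (simp add: q_def bounded_operatorD[OF Cm] cinner_scaleC_left sum_distrib_left algebra_simps)
    show "q j x y = cnj (q j y x)" for x y
      by (simp add: q_def cinner_commute[symmetric] add.commute)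
  qed
  define D where "D j x = (1 / lam j) *\<^sub>C C x" for j x
  have D: "bounded_operator (D j)" for j unfolding D_def by (rule bounded_operator_scale[OF C])
  have normD: "norm (D j x) \<le> r * norm x" for j x
    using c(3)[of x] s(1) by (simp add: D_def norm_scaleC norm_divide nlam r_def divide_right_mono)
  have Dm: "(D j ^^ m) x = (1 / lam j) ^ m *\<^sub>C (C ^^ m) x" for j m x
    by (induction m) (simp_all add: D_def bounded_operatorD[OF C])
  have Req: "Re (q j x x) = ((norm x)\<^sup>2 + 2 * (\<Sum>m=1..M. inner ((D j ^^ m) x) x)) / N" for j x
  proof -
    have "(1 / lam j) ^ m * cinner ((C ^^ m) x) x + cnj ((1 / lam j) ^ m) * cinner x ((C ^^ m) x)
        = complex_of_real (2 * inner ((D j ^^ m) x) x)" for m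
    proof -
      have "cnj ((1 / lam j) ^ m) * cinner x ((C ^^ m) x) = cnj ((1 / lam j) ^ m * cinner ((C ^^ m) x) x)"
        by (simp flip: cinner_commute)
      then show ?thesis
        unfolding inner_eq_Re_cinner Dm cinner_scaleC_left by (simp only: complex_add_cnj)
    qed
    then have "q j x x = complex_of_real (((norm x)\<^sup>2 + 2 * (\<Sum>m=1..M. inner ((D j ^^ m) x) x)) / N)"
      by (simp add: q_def cinner_self sum_distrib_left)
    then show ?thesis by (simp only: Re_complex_of_real)
  qed
  have pos: "positive_form (q j)" for j
    using truncated_poisson_kernel_positive[OF D r normD M] ses
    by (simp add: positive_form_def Req)
  have bound: "Re (q j x x) \<le> (1 + 2 * real M) * (norm x)\<^sup>2" for j x
  proof -
    have "norm ((D j ^^ m) x) \<le> norm x" for m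
    proof (induction m)
      case (Suc m)
      have "norm ((D j ^^ Suc m) x) \<le> r * norm ((D j ^^ m) x)" using normD by simp
      also have "\<dots> \<le> norm ((D j ^^ m) x)" using r by (simp add: mult_left_le_one_le)
      finally show ?case using Suc by simp
    qed simp
    then have "inner ((D j ^^ m) x) x \<le> (norm x)\<^sup>2" for m
      using norm_cauchy_schwarz[of "(D j ^^ m) x" x] mult_right_mono[of _ _ "norm x"]
      unfolding power2_eq_square by (meson norm_ge_zero order_trans)
    then have "(\<Sum>m=1..M. inner ((D j ^^ m) x) x) \<le> (\<Sum>m=1..M. (norm x)\<^sup>2)"
      by (intro sum_mono) auto
    then have *: "(norm x)\<^sup>2 + 2 * (\<Sum>m=1..M. inner ((D j ^^ m) x) x) \<le> (1 + 2 * real M) * (norm x)\<^sup>2"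
      by (simp add: algebra_simps)
    have "Re (q j x x) \<le> ((1 + 2 * real M) * (norm x)\<^sup>2) / N"
      unfolding Req by (rule divide_right_mono[OF *]) simp
    also have "\<dots> \<le> ((1 + 2 * real M) * (norm x)\<^sup>2) / 1"
      by (intro divide_left_mono) (auto simp: N_def)
    finally show ?thesis by simp
  qed
  have S1: "(\<Sum>j<N. lam j ^ k * (1 / lam j) ^ m) = (if k = m then of_nat N else 0)"
    if "k \<le> M" "m \<le> M" for k m
  proof -
    define z where "z = w ^ k / w ^ m"
    have summand: "lam j ^ k * (1 / lam j) ^ m = complex_of_real (s ^ k / s ^ m) * z ^ j" for j
      using s by (simp add: lam_def z_def power_mult_distrib power_divide mult.commute flip: power_mult)
    have "z ^ N = 1"
      by (simp add: z_def power_divide wpN)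
    moreover have "z = 1 \<longleftrightarrow> k = m"
      using that w0 weq[of k m] by (simp add: z_def N_def)
    ultimately show ?thesis
      using s unfolding summand sum_distrib_left[symmetric] by (simp add: sum_powers_root_of_unity)
  qed
  have S2: "(\<Sum>j<N. lam j ^ k * cnj ((1 / lam j) ^ m)) = 0"
    if "k \<le> M" "m \<le> M" "m \<ge> 1" for k m
  proof -
    define z where "z = w ^ (k + m)"
    have "cnj w = 1 / w"
      using complex_norm_square[of w] nw w0 by (simp add: field_simps)
    then have "cnj (1 / lam j) = w ^ j / complex_of_real s" for j
      by (simp add: lam_def power_one_over)
    then have inv: "cnj ((1 / lam j) ^ m) = (w ^ j / complex_of_real s) ^ m" for j
      by (simp only: complex_cnj_power)
    have summand: "lam j ^ k * cnj ((1 / lam j) ^ m) = complex_of_real (s ^ k / s ^ m) * z ^ j" for j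
      unfolding inv
      by (simp add: lam_def z_def power_mult_distrib power_divide power_add mult.commute flip: power_mult)
    have "z ^ N = 1"
      by (simp add: z_def wpN)
    moreover have "z \<noteq> 1"
      using that weq[of "k + m" 0] by (simp add: z_def N_def)
    ultimately show ?thesis
      unfolding summand sum_distrib_left[symmetric] by (simp add: sum_powers_root_of_unity)
  qed
  have quad: "(\<Sum>j<N. lam j ^ k * q j x y) = cinner ((C ^^ k) x) y" if k: "k \<le> n" for k x y
  proof -
    have kM: "k \<le> M" using k nM by simp
    have S0: "(\<Sum>j<N. lam j ^ k) = (if k = 0 then of_nat N else 0)"
      using S1[OF kM, of 0] by simp
    have "(\<Sum>j<N. lam j ^ k * q j x y) = ((\<Sum>j<N. lam j ^ k) * cinner x y
      + (\<Sum>m=1..M. (\<Sum>j<N. lam j ^ k * (1 / lam j) ^ m) * cinner ((C ^^ m) x) y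
        + (\<Sum>j<N. lam j ^ k * cnj ((1 / lam j) ^ m)) * cinner x ((C ^^ m) y))) / of_nat N"
      unfolding q_def times_divide_eq_right sum_divide_distrib[symmetric]
      by (simp add: distrib_left sum.distrib sum_distrib_left sum_distrib_right mult.assoc
          sum.swap[of _ "{Suc 0..M}" "{..<N}"])
    also have "\<dots> = ((if k = 0 then of_nat N else 0) * cinner x y
      + (\<Sum>m=1..M. if m = k then of_nat N * cinner ((C ^^ k) x) y else 0)) / of_nat N"
      unfolding S0 using S1[OF kM] S2[OF kM]
      by (intro arg_cong2[where f = "(/)"] arg_cong2[where f = "(+)"] sum.cong refl) auto
    also have "\<dots> = cinner ((C ^^ k) x) y"
    proof -
      have "(of_nat N :: complex) \<noteq> 0" by (simp add: N_def del: of_nat_Suc of_nat_add)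
      then show ?thesis using kM by (cases "k = 0") auto
    qed
    finally show ?thesis .
  qed
  show thesis
    by (rule that[of lam q "1 + 2 * real M" N]) (use pos bound quad nlam s in auto)
qed

section \<open>The isometric embedding\<close>

instance complex_hilbert_space \<subseteq> banach ..

lemma separable_dense_sequence:
  assumes "separable_space (euclidean :: ('a::real_normed_vector) topology)"
  obtains d :: "nat \<Rightarrow> 'a::real_normed_vector" where "\<And>x e. e > 0 \<Longrightarrow> \<exists>i. norm (x - d i) < e"
proof -
  obtain S :: "'a set" where S: "countable S" "closure S = UNIV"
    using assms by (auto simp: separable_space_def)
  then have "S \<noteq> {}" by auto
  have "\<exists>i. norm (x - from_nat_into S i) < e" if e: "e > 0" for x and e :: real
  proof -
    have "x \<in> closure S" using S(2) by simp
    then obtain y where y: "y \<in> S" "dist y x < e" using e closure_approachable by blast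
    then obtain i where "from_nat_into S i = y" using from_nat_into_surj[OF S(1)] by blast
    with y show ?thesis by (metis dist_commute dist_norm)
  qed
  then show thesis by (rule that)
qed

text \<open>With \<open>\<langle>C ^^ k x, y\<rangle> = (\<Sum>j. lam j ^ k * q j x y)\<close> and \<open>q j x y = (\<Sum>i. \<phi> j i x * cnj (\<phi> j i y))\<close>,
  it suffices to send \<open>x\<close> to \<open>\<Sum>i j. \<phi> j i x E(i, j)\<close>, where the vectors \<open>E(i, j)\<close> have mutually
  orthogonal orbits and moments \<open>lam j ^ k\<close>. The case \<open>k = 0\<close> says that this map is isometric.\<close>

lemma isometric_power_dilation:
  fixes T :: "'h::complex_hilbert_space \<Rightarrow> 'h" and C :: "'k::complex_hilbert_space \<Rightarrow> 'k"
  assumes T: "bounded_operator T"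
    and hull: "ball 0 1 \<subseteq> polynomial_hull (op_spectrum T)"
    and sep: "separable_space (euclidean :: 'k topology)"
    and C: "bounded_operator C" and c: "0 \<le> c" "c < 1" "\<And>x. norm (C x) \<le> c * norm x"
  obtains V :: "'k \<Rightarrow> 'h" where "\<forall>x y. V (x + y) = V x + V y" "\<forall>a x. V (a *\<^sub>C x) = a *\<^sub>C V x"
    "\<forall>k\<le>n. \<forall>x y. cinner ((T ^^ k) (V x)) (V y) = cinner ((C ^^ k) x) y"
proof -
  obtain N :: nat and lam :: "nat \<Rightarrow> complex" and q :: "nat \<Rightarrow> 'k \<Rightarrow> 'k \<Rightarrow> complex" and B :: real
    where lam: "\<forall>j. lam j \<in> ball 0 1" and q: "\<forall>j. positive_form (q j)"
      "\<forall>j x. Re (q j x x) \<le> B * (norm x)\<^sup>2"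
      and quad: "\<forall>k\<le>n. \<forall>x y. (\<Sum>j<N. lam j ^ k * q j x y) = cinner ((C ^^ k) x) y"
    by (rule strict_contraction_quadrature[OF C c])
  obtain d :: "nat \<Rightarrow> 'k" where d: "\<And>x e. e > 0 \<Longrightarrow> \<exists>i. norm (x - d i) < e"
    using separable_dense_sequence[OF sep] by blast
  let ?Q = "\<lambda>j (\<phi> :: nat \<Rightarrow> 'k \<Rightarrow> complex). (\<forall>i x y. \<phi> i (x + y) = \<phi> i x + \<phi> i y) \<and>
      (\<forall>i a x. \<phi> i (a *\<^sub>C x) = a * \<phi> i x) \<and> (\<forall>x y. (\<lambda>i. \<phi> i x * cnj (\<phi> i y)) sums q j x y)"
  have "\<exists>\<phi>. ?Q j \<phi>" for j
    by (rule positive_form_decomposition[of "q j" B d]) (use q d in auto)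
  then have "\<exists>\<phi>. \<forall>j. ?Q j (\<phi> j)" by (intro choice allI)
  then obtain \<phi> :: "nat \<Rightarrow> nat \<Rightarrow> 'k \<Rightarrow> complex" where "\<forall>j. ?Q j (\<phi> j)" by (elim exE)
  then have phi: "\<And>j i x y. \<phi> j i (x + y) = \<phi> j i x + \<phi> j i y"
      "\<And>j i a x. \<phi> j i (a *\<^sub>C x) = a * \<phi> j i x"
      "\<And>j x y. (\<lambda>i. \<phi> j i x * cnj (\<phi> j i y)) sums q j x y"
    by simp_all
  let ?P = "\<lambda>m x. \<forall>k\<le>n. cinner ((T ^^ k) x) x = lam (snd (prod_decode m)) ^ k"
  have "\<exists>x. orthogonal_to x F \<and> ?P m x" if "finite F" for m F
    using vector_with_prescribed_moments[OF T hull lam[rule_format] that] by metis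
  then obtain e where e: "\<forall>m. ?P m (e m)"
    and orth: "\<forall>i j k. i \<noteq> j \<longrightarrow> k \<le> n \<longrightarrow> cinner ((T ^^ k) (e i)) (e j) = 0"
    by (rule orthogonal_orbit_sequence[OF T, of ?P n])
  define E where "E p = e (prod_encode p)" for p
  have E: "cinner ((T ^^ k) (E p)) (E p) = lam (snd p) ^ k" if "k \<le> n" for k p
    using e that by (simp add: E_def)
  have Eorth: "cinner ((T ^^ k) (E p)) (E p') = 0" if "k \<le> n" "p \<noteq> p'" for k p p'
    using orth that by (simp add: E_def)
  define u where "u x i = (\<Sum>j<N. \<phi> j i x *\<^sub>C E (i, j))" for x i
  have moments: "cinner ((T ^^ k) (\<Sum>i\<in>I. u x i)) (\<Sum>i\<in>I. u y i)
      = (\<Sum>i\<in>I. \<Sum>j<N. lam j ^ k * (\<phi> j i x * cnj (\<phi> j i y)))" if k: "k \<le> n" and I: "finite I" for k I x y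
  proof -
    have u: "(\<Sum>i\<in>I. u x i) = (\<Sum>p\<in>I \<times> {..<N}. \<phi> (snd p) (fst p) x *\<^sub>C E p)" for x
      unfolding u_def sum.cartesian_product by (intro sum.cong refl) auto
    have "cinner ((T ^^ k) (\<Sum>i\<in>I. u x i)) (\<Sum>i\<in>I. u y i)
        = (\<Sum>p\<in>I \<times> {..<N}. \<phi> (snd p) (fst p) x * cnj (\<phi> (snd p) (fst p) y) * cinner ((T ^^ k) (E p)) (E p))"
      unfolding u using I Eorth[OF k]
      by (intro cinner_sum_orthogonal bounded_operator_funpow T) auto
    also have "\<dots> = (\<Sum>i\<in>I. \<Sum>j<N. lam j ^ k * (\<phi> j i x * cnj (\<phi> j i y)))"
      unfolding sum.cartesian_product
      by (intro sum.cong refl) (auto simp: E[OF k] split_beta)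
    finally show ?thesis .
  qed
  have square: "(norm (\<Sum>i\<in>I. u x i))\<^sup>2 = (\<Sum>i\<in>I. \<Sum>j<N. (cmod (\<phi> j i x))\<^sup>2)" if "finite I" for I x
  proof -
    have "complex_of_real ((norm (\<Sum>i\<in>I. u x i))\<^sup>2) = complex_of_real (\<Sum>i\<in>I. \<Sum>j<N. (cmod (\<phi> j i x))\<^sup>2)"
      using moments[of 0 I x x] that by (simp add: cinner_self complex_norm_square flip: of_real_power)
    then show ?thesis by (simp only: of_real_eq_iff)
  qed
  have square_summable: "summable (\<lambda>i. \<Sum>j<N. (cmod (\<phi> j i x))\<^sup>2)" for x
  proof (rule summable_sum)
    fix j
    have "(\<lambda>i. Re (\<phi> j i x * cnj (\<phi> j i x))) sums Re (q j x x)"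
      by (rule sums_Re[OF phi(3)])
    then show "summable (\<lambda>i. (cmod (\<phi> j i x))\<^sup>2)"
      by (simp add: sums_summable flip: complex_norm_square)
  qed
  have summ: "summable (u x)" for x
    unfolding summable_Cauchy
  proof (intro allI impI)
    fix r :: real assume "r > 0"
    then have "r\<^sup>2 > 0" by simp
    then obtain N' where N': "\<And>m n. m \<ge> N' \<Longrightarrow> norm (\<Sum>i = m..<n. \<Sum>j<N. (cmod (\<phi> j i x))\<^sup>2) < r\<^sup>2"
      using square_summable[of x, unfolded summable_Cauchy] by blast
    have "norm (sum (u x) {m..<n}) < r" if "m \<ge> N'" for m n
    proof -
      have "(norm (sum (u x) {m..<n}))\<^sup>2 < r\<^sup>2"
        using N'[OF that, of n] square[of "{m..<n}" x] by simp
      then show ?thesis by (rule power2_less_imp_less) (use \<open>r > 0\<close> in simp)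
    qed
    then show "\<exists>N'. \<forall>m\<ge>N'. \<forall>n. norm (sum (u x) {m..<n}) < r" by blast
  qed
  define V where "V x = (\<Sum>i. u x i)" for x
  have lim: "(\<lambda>m. \<Sum>i<m. u x i) \<longlonglongrightarrow> V x" for x
    unfolding V_def by (rule summable_LIMSEQ[OF summ])
  have "cinner ((T ^^ k) (V x)) (V y) = cinner ((C ^^ k) x) y" if k: "k \<le> n" for k x y
  proof (rule LIMSEQ_unique)
    have bl: "bounded_linear (T ^^ k)"
      by (rule bounded_operatorD(1)[OF bounded_operator_funpow[OF T]])
    show "(\<lambda>m. cinner ((T ^^ k) (\<Sum>i<m. u x i)) (\<Sum>i<m. u y i)) \<longlonglongrightarrow> cinner ((T ^^ k) (V x)) (V y)"
      by (intro cinner.tendsto bounded_linear.tendsto[OF bl] lim)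
    have "(\<lambda>i. \<Sum>j<N. lam j ^ k * (\<phi> j i x * cnj (\<phi> j i y))) sums (\<Sum>j<N. lam j ^ k * q j x y)"
      by (intro sums_sum sums_mult phi(3))
    then show "(\<lambda>m. cinner ((T ^^ k) (\<Sum>i<m. u x i)) (\<Sum>i<m. u y i)) \<longlonglongrightarrow> cinner ((C ^^ k) x) y"
      using quad k by (simp add: sums_def moments)
  qed
  moreover have "V (x + y) = V x + V y" for x y
  proof -
    have "u (x + y) = (\<lambda>i. u x i + u y i)"
      by (intro ext) (simp add: u_def phi(1) scaleC.scale_left_distrib sum.distrib)
    then show ?thesis by (simp add: V_def suminf_add[OF summ summ])
  qed
  moreover have "V (a *\<^sub>C x) = a *\<^sub>C V x" for a x
  proof -
    have "u (a *\<^sub>C x) = (\<lambda>i. a *\<^sub>C u x i)"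
      by (intro ext) (simp add: u_def phi(2) scaleC.scale_sum_right)
    then show ?thesis
      by (simp add: V_def bounded_linear.suminf[OF scaleC_bilinear.bounded_linear_right summ])
  qed
  ultimately show thesis by (intro that[of V]) auto
qed

theorem theorem1p3:
  fixes T :: "'h::complex_hilbert_space \<Rightarrow> 'h"
    and C' :: "'k::complex_hilbert_space \<Rightarrow> 'k"
    and n :: nat
  assumes "T \<in> bounded_operators UNIV"
    and "ball 0 1 \<subseteq> polynomial_hull (op_spectrum T)"
    and "separable_space (euclidean :: 'k topology)"
    and "C' \<in> bounded_operators UNIV"
    and "onorm C' < 1"
  shows "\<exists>L C. csubspace L \<and> closed L \<and> C \<in> bounded_operators L \<and>
           unitarily_equivalent L C UNIV C' \<and>
           (\<forall>k\<in>{1..n}. \<forall>x\<in>L. compression L (T ^^ k) x = (C ^^ k) x)"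
proof -
  note C' = bounded_operatorD[OF assms(4)]
  have c: "0 \<le> onorm C'" "\<And>x. norm (C' x) \<le> onorm C' * norm x"
    using onorm_pos_le[OF C'(1)] onorm[OF C'(1)] by auto
  obtain V :: "'k \<Rightarrow> 'h" where V: "\<forall>x y. V (x + y) = V x + V y" "\<forall>a x. V (a *\<^sub>C x) = a *\<^sub>C V x"
    and dil: "\<forall>k\<le>n. \<forall>x y. cinner ((T ^^ k) (V x)) (V y) = cinner ((C' ^^ k) x) y"
    by (rule isometric_power_dilation[OF assms(1-4) c(1) assms(5) c(2)])
  have iso: "cinner (V x) (V y) = cinner x y" for x y
    using dil[rule_format, of 0] by simp
  have normV: "norm (V x) = norm x" for x
    using iso[of x x] by (simp add: cinner_self) (metis norm_ge_zero of_real_eq_iff of_real_power power2_eq_iff_nonneg)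
  have blV: "bounded_linear V"
    by (rule bounded_linear_intro[of _ 1]) (simp_all add: V normV scaleR_eq_scaleC)
  have injV: "inj V"
  proof (rule injI)
    fix x y assume "V x = V y"
    then have "norm (V (x - y)) = 0"
      by (simp add: linear_diff[OF bounded_linear.linear[OF blV]])
    then show "x = y" by (simp add: normV)
  qed
  define L where "L = range V"
  define U where "U = inv V"
  have UV: "U (V x) = x" for x unfolding U_def by (rule inv_f_f[OF injV])
  define C where "C z = V (C' (U z))" for z
  have sub: "csubspace L"
    unfolding csubspace_def L_def
  proof (intro conjI ballI allI)
    show "0 \<in> range V" using linear_0[OF bounded_linear.linear[OF blV]] by (metis rangeI)
    show "x + y \<in> range V" if "x \<in> range V" "y \<in> range V" for x y
      using that by (auto simp flip: V(1)[rule_format])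
    show "a *\<^sub>C x \<in> range V" if "x \<in> range V" for a x
      using that by (auto simp flip: V(2)[rule_format])
  qed
  have "complete L"
    unfolding L_def by (rule complete_isometric_image[of 1]) (auto simp: blV normV complete_UNIV)
  then have cl: "closed L" by (rule complete_imp_closed)
  have CV: "(C ^^ k) (V x) = V ((C' ^^ k) x)" for k x
    by (induction k) (simp_all add: C_def UV)
  have "C \<in> bounded_operators L"
    unfolding bounded_operators_def clinear_on_def L_def
  proof (intro CollectI conjI ballI allI exI[of _ "onorm C'"])
    show "C x \<in> range V" for x by (simp add: C_def)
    show "C (x + y) = C x + C y" if xy: "x \<in> range V" "y \<in> range V" for x y
    proof -
      obtain a b where "x = V a" "y = V b" using xy by blast
      then show ?thesis by (simp only: V(1)[rule_format, symmetric] C_def UV C'(3))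
    qed
    show "C (a *\<^sub>C x) = a *\<^sub>C C x" if xy: "x \<in> range V" for a x
    proof -
      obtain b where "x = V b" using xy by blast
      then show ?thesis by (simp only: V(2)[rule_format, symmetric] C_def UV C'(2))
    qed
    show "norm (C x) \<le> onorm C' * norm x" if "x \<in> range V" for x
      using that c(2) by (auto simp: C_def UV normV)
  qed
  moreover have "unitarily_equivalent L C UNIV C'"
    unfolding unitarily_equivalent_def unitary_between_def clinear_on_def
  proof (intro exI[of _ U] conjI ballI allI)
    show "bij_betw U L UNIV" unfolding U_def L_def by (rule bij_betw_inv_into[OF inj_on_imp_bij_betw[OF injV]])
    show "U (x + y) = U x + U y" if xy: "x \<in> L" "y \<in> L" for x y
    proof -
      obtain a b where "x = V a" "y = V b" using xy L_def by blast
      then show ?thesis by (simp only: V(1)[rule_format, symmetric] UV)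
    qed
    show "U (a *\<^sub>C x) = a *\<^sub>C U x" if xy: "x \<in> L" for a x
    proof -
      obtain b where "x = V b" using xy L_def by blast
      then show ?thesis by (simp only: V(2)[rule_format, symmetric] UV)
    qed
    show "cinner (U x) (U y) = cinner x y" if "x \<in> L" "y \<in> L" for x y
      using that by (auto simp: L_def UV iso)
    show "U (C x) = C' (U x)" for x by (simp add: C_def UV)
  qed
  moreover have "compression L (T ^^ k) x = (C ^^ k) x" if k: "k \<in> {1..n}" and x: "x \<in> L" for k x
  proof -
    obtain y where y: "x = V y" using x by (auto simp: L_def)
    have "cinner ((T ^^ k) x - (C ^^ k) x) z = 0" if "z \<in> L" for z
      using that dil k by (auto simp: L_def y CV cinner.diff_left iso)
    moreover have "(C ^^ k) x \<in> L" by (simp add: y CV L_def)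
    ultimately show ?thesis
      unfolding compression_def orth_proj_def
      by (intro the1_equality orth_proj_exists_unique[OF sub cl]) blast
  qed
  ultimately show ?thesis using sub cl by blast
qed

end
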